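(* Let $k\ge 3$, let $\alpha_1,\alpha_2,\alpha_3\in\mathbb{R}$ be pairwise distinct with $\alpha_1<\alpha_3$ and $\alpha_2<\alpha_3$, let $K:=\{(x,y)\in\mathbb{R}^2:(y-\alpha_1)(y-\alpha_2)(y-\alpha_3)=0\}$, and let $\beta=(\beta_{i,j})_{i,j\in\mathbb{Z}_+,\,i+j\le 2k}$ be a real bivariate sequence of degree $2k$ with $\beta_{0,0}>0$ and moment matrix $M_k$. Assume that $M_k$ has the column relation $(Y-\alpha_1)(Y-\alpha_2)(Y-\alpha_3)=\mathbf 0$, is recursively generated, and that the restriction $(M_k)|_{\mathcal C^{(2)}}$ of $M_k$ to the rows and columns indexed by $$\mathcal C^{(2)}=\{X^i: 0\le i\le k\}\cup\{YX^i:0\le i\le k-1\}\cup\{Y^2X^i:0\le i\le k-2\}$$ is positive definite. Then $\beta$ has a $K$-representing measure if and only if the matrix $N$ defined in the context is positive semidefinite. Moreover, if $\beta$ has a $K$-representing measure, then a $(\operatorname{rank}M_k)$-atomic $K$-representing measure exists.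
   Context: $\mathbb{Z}_+$ denotes the nonnegative integers. For closed $K\subseteq\mathbb{R}^2$, a $K$-representing measure for $\beta$ is a positive Borel measure $\mu$ with support contained in $K$ such that $\beta_{i,j}=\int_K x^iy^j\,d\mu$ whenever $i+j\le 2k$. A measure is $r$-atomic if it is of the form $\sum_{j=1}^r\rho_j\delta_{z_j}$ with $\rho_j>0$ and pairwise distinct points $z_j$. The moment matrix $M_k$ has rows and columns indexed by $X^iY^j$, $i+j\le k$, with entry $\beta_{i+i',j+j'}$ in row $X^iY^j$ and column $X^{i'}Y^{j'}$. For a polynomial $p=\sum_{i+j\le k} a_{i,j}x^iy^j$ write $p(X,Y)=\sum a_{i,j}X^iY^j$ for the corresponding linear combination of columns; $p(X,Y)=\mathbf 0$ is called a column relation. $M_k$ is recursively generated if whenever $p,q,pq$ are polynomials of degree at most $k$ with $p(X,Y)=\mathbf 0$, also $(pq)(X,Y)=\mathbf 0$. Put $\widetilde\alpha_2=\alpha_2-\alpha_1$, $\widetilde\alpha_3=\alpha_3-\alpha_1$. For $i+j\le 2k$ let $\widetilde\beta_{i,j}=L_\beta\big(x^i(y-\alpha_1)^j\big)$, where $L_\beta$ is the linear functional on polynomials of degree at most $2k$ with $L_\beta(x^iy^j)=\beta_{i,j}$. Define also $$\widetilde\beta_{2k-3,4}=(\widetilde\alpha_2+\widetilde\alpha_3)\widetilde\beta_{2k-3,3}-\widetilde\alpha_2\widetilde\alpha_3\widetilde\beta_{2k-3,2},\quad \widetilde\beta_{2k-2,3}=(\widetilde\alpha_2+\widetilde\alpha_3)\widetilde\beta_{2k-2,2}-\widetilde\alpha_2\widetilde\alpha_3\widetilde\beta_{2k-2,1},$$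 $$\widetilde\beta_{2k-2,4}=(\widetilde\alpha_2+\widetilde\alpha_3)\widetilde\beta_{2k-2,3}-\widetilde\alpha_2\widetilde\alpha_3\widetilde\beta_{2k-2,2}.$$ $N$ is the $3k\times 3k$ matrix with rows and columns indexed by $X^i,\ YX^i,\ Y^2X^i$, $0\le i\le k-1$, whose entry in row $Y^pX^i$ and column $Y^qX^j$ is $\widetilde\beta_{i+j,p+q}$. *)

theory Defs
  imports
    "HOL-Analysis.Analysis"
    "HOL-Probability.Giry_Monad"
    "HOL-Computational_Algebra.Polynomial"
    "Jordan_Normal_Form.DL_Rank"
begin

text \<open>
  A bivariate polynomial \<open>p\<close> is an element of \<open>real poly poly\<close>: the outer variable is \<open>y\<close>,
  the inner one is \<open>x\<close>, so the coefficient of \<open>x\<^sup>i y\<^sup>j\<close> is \<open>coeff (coeff p j) i\<close>.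
  A bivariate sequence of degree \<open>2k\<close> is a function \<open>nat \<Rightarrow> nat \<Rightarrow> real\<close> of which only the
  values at \<open>i + j \<le> 2k\<close> are ever used.
  A monomial \<open>X\<^sup>i Y\<^sup>j\<close> is encoded by the pair \<open>(i, j)\<close>.
\<close>

definition polyX :: "real poly poly" where
  "polyX = [:[:0, 1:]:]"

definition polyY :: "real poly poly" where
  "polyY = [:0, 1:]"

definition polyC :: "real \<Rightarrow> real poly poly" where
  "polyC c = [:[:c:]:]"

definition total_degree_le :: "nat \<Rightarrow> real poly poly \<Rightarrow> bool" where
  "total_degree_le d p \<longleftrightarrow> (\<forall>i j. coeff (coeff p j) i \<noteq> 0 \<longrightarrow> i + j \<le> d)"

definition riesz :: "(nat \<Rightarrow> nat \<Rightarrow> real) \<Rightarrow> real poly poly \<Rightarrow> real" where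
  "riesz \<beta> p = (\<Sum>j\<le>degree p. \<Sum>i\<le>degree (coeff p j). coeff (coeff p j) i * \<beta> i j)"

text \<open>The matrix with entry \<open>\<beta> (i + i') (j + j')\<close> in row \<open>(i, j)\<close> and column \<open>(i', j')\<close>,
  where rows and columns are indexed, in order, by the monomials in the list \<open>ms\<close>.\<close>

definition moment_matrix_on ::
    "(nat \<times> nat) list \<Rightarrow> (nat \<Rightarrow> nat \<Rightarrow> real) \<Rightarrow> real Matrix.mat" where
  "moment_matrix_on ms \<beta> =
     Matrix.mat (length ms) (length ms)
       (\<lambda>(a, b). \<beta> (fst (ms ! a) + fst (ms ! b)) (snd (ms ! a) + snd (ms ! b)))"

text \<open>All monomials of degree at most \<open>k\<close>, in degree-lexicographic order
  \<open>1, X, Y, X\<^sup>2, XY, Y\<^sup>2, \<dots>\<close>\<close>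

definition monomials_upto :: "nat \<Rightarrow> (nat \<times> nat) list" where
  "monomials_upto k = concat (map (\<lambda>d. map (\<lambda>j. (d - j, j)) [0..<d + 1]) [0..<k + 1])"

definition moment_matrix :: "nat \<Rightarrow> (nat \<Rightarrow> nat \<Rightarrow> real) \<Rightarrow> real Matrix.mat" where
  "moment_matrix k \<beta> = moment_matrix_on (monomials_upto k) \<beta>"

text \<open>\<open>p(X, Y)\<close>: the linear combination of the columns of \<open>M\<^sub>k\<close> with the coefficients
  of \<open>p\<close> (for \<open>p\<close> of degree at most \<open>k\<close>).\<close>

definition column_eval ::
    "nat \<Rightarrow> (nat \<Rightarrow> nat \<Rightarrow> real) \<Rightarrow> real poly poly \<Rightarrow> real Matrix.vec" where
  "column_eval k \<beta> p =
     moment_matrix k \<beta> *\<^sub>v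
       Matrix.vec (length (monomials_upto k))
         (\<lambda>a. coeff (coeff p (snd (monomials_upto k ! a))) (fst (monomials_upto k ! a)))"

definition column_relation ::
    "nat \<Rightarrow> (nat \<Rightarrow> nat \<Rightarrow> real) \<Rightarrow> real poly poly \<Rightarrow> bool" where
  "column_relation k \<beta> p \<longleftrightarrow>
     total_degree_le k p \<and> column_eval k \<beta> p = 0\<^sub>v (length (monomials_upto k))"

definition recursively_generated :: "nat \<Rightarrow> (nat \<Rightarrow> nat \<Rightarrow> real) \<Rightarrow> bool" where
  "recursively_generated k \<beta> \<longleftrightarrow>
     (\<forall>p q. total_degree_le k p \<and> total_degree_le k q \<and> total_degree_le k (p * q) \<and>
        column_relation k \<beta> p \<longrightarrow> column_relation k \<beta> (p * q))"

definition mat_rank :: "real Matrix.mat \<Rightarrow> nat" where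
  "mat_rank A = vec_space.rank (dim_row A) A"

definition pos_semidef :: "real Matrix.mat \<Rightarrow> bool" where
  "pos_semidef A \<longleftrightarrow>
     square_mat A \<and> A\<^sup>T = A \<and> (\<forall>v \<in> carrier_vec (dim_row A). 0 \<le> v \<bullet> (A *\<^sub>v v))"

definition pos_def :: "real Matrix.mat \<Rightarrow> bool" where
  "pos_def A \<longleftrightarrow>
     square_mat A \<and> A\<^sup>T = A \<and>
     (\<forall>v \<in> carrier_vec (dim_row A). v \<noteq> 0\<^sub>v (dim_row A) \<longrightarrow> 0 < v \<bullet> (A *\<^sub>v v))"

definition measure_support :: "'a::topological_space measure \<Rightarrow> 'a set" where
  "measure_support \<mu> = {z. \<forall>U. open U \<and> z \<in> U \<longrightarrow> emeasure \<mu> U > 0}"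

definition representing_measure ::
    "nat \<Rightarrow> (real \<times> real) set \<Rightarrow> (nat \<Rightarrow> nat \<Rightarrow> real) \<Rightarrow> (real \<times> real) measure \<Rightarrow> bool" where
  "representing_measure k K \<beta> \<mu> \<longleftrightarrow>
     sets \<mu> = sets borel \<and> measure_support \<mu> \<subseteq> K \<and>
     (\<forall>i j. i + j \<le> 2 * k \<longrightarrow>
        set_integrable \<mu> K (\<lambda>(x, y). x ^ i * y ^ j) \<and>
        \<beta> i j = set_lebesgue_integral \<mu> K (\<lambda>(x, y). x ^ i * y ^ j))"

text \<open>\<open>return borel z\<close> is the Dirac measure at \<open>z\<close>.\<close>

definition atomic_measure :: "nat \<Rightarrow> (real \<times> real) measure \<Rightarrow> bool" where
  "atomic_measure r \<mu> \<longleftrightarrow>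
     sets \<mu> = sets borel \<and>
     (\<exists>Z \<rho>. finite Z \<and> card Z = r \<and> (\<forall>z\<in>Z. (0::real) < \<rho> z) \<and>
        (\<forall>A\<in>sets borel. emeasure \<mu> A = (\<Sum>z\<in>Z. ennreal (\<rho> z) * emeasure (return borel z) A)))"

text \<open>For \<open>k \<ge> 2\<close> every monomial of \<open>C2 k\<close> has degree at most \<open>k\<close>, so
  \<open>moment_matrix_on (C2 k) \<beta>\<close> is the restriction of \<open>M\<^sub>k\<close> to these rows and columns.\<close>

definition C2 :: "nat \<Rightarrow> (nat \<times> nat) list" where
  "C2 k = map (\<lambda>i. (i, 0)) [0..<k + 1] @ map (\<lambda>i. (i, 1)) [0..<k] @ map (\<lambda>i. (i, 2)) [0..<k - 1]"

definition shifted_moment :: "(nat \<Rightarrow> nat \<Rightarrow> real) \<Rightarrow> real \<Rightarrow> nat \<Rightarrow> nat \<Rightarrow> real" where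
  "shifted_moment \<beta> \<alpha>1 i j = riesz \<beta> (polyX ^ i * (polyY - polyC \<alpha>1) ^ j)"

text \<open>The shifted moments of degree at most \<open>2k\<close>, together with the three auxiliary ones of
  degree \<open>2k + 1\<close> and \<open>2k + 2\<close>.\<close>

definition extended_moment ::
    "nat \<Rightarrow> (nat \<Rightarrow> nat \<Rightarrow> real) \<Rightarrow> real \<Rightarrow> real \<Rightarrow> real \<Rightarrow> nat \<Rightarrow> nat \<Rightarrow> real" where
  "extended_moment k \<beta> \<alpha>1 \<alpha>2 \<alpha>3 i j =
     (let a2 = \<alpha>2 - \<alpha>1; a3 = \<alpha>3 - \<alpha>1; s = shifted_moment \<beta> \<alpha>1;
          b34 = (a2 + a3) * s (2 * k - 3) 3 - a2 * a3 * s (2 * k - 3) 2;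
          b23 = (a2 + a3) * s (2 * k - 2) 2 - a2 * a3 * s (2 * k - 2) 1;
          b24 = (a2 + a3) * b23 - a2 * a3 * s (2 * k - 2) 2
      in if (i, j) = (2 * k - 3, 4) then b34
         else if (i, j) = (2 * k - 2, 3) then b23
         else if (i, j) = (2 * k - 2, 4) then b24
         else s i j)"

definition N_matrix ::
    "nat \<Rightarrow> (nat \<Rightarrow> nat \<Rightarrow> real) \<Rightarrow> real \<Rightarrow> real \<Rightarrow> real \<Rightarrow> real Matrix.mat" where
  "N_matrix k \<beta> \<alpha>1 \<alpha>2 \<alpha>3 =
     moment_matrix_on
       (map (\<lambda>i. (i, 0)) [0..<k] @ map (\<lambda>i. (i, 1)) [0..<k] @ map (\<lambda>i. (i, 2)) [0..<k])
       (extended_moment k \<beta> \<alpha>1 \<alpha>2 \<alpha>3)"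

end

(*
  On a line y = c the sequence beta reduces to a univariate one, obtained from beta(i, 0), beta(i, 1),
  beta(i, 2) by Lagrange interpolation in y. The three univariate sequences m_y are determined up to
  degree 2k - 2; in degree 2k - 1 one parameter and in degree 2k two parameters are free. The matrix N
  is congruent to the direct sum of the three Hankel matrices of degree 2k - 2.

  Let g_y, h_y be the monic polynomials of degrees k - 1 and k that are orthogonal to all polynomials of
  degree < k - 1, where h_y has no term of degree k - 1, and put d = L(g^2), e = L(h g), f = L(h^2) on
  each line. Positive definiteness on C2 says that sum_y (f_y + 2 c_y e_y + c_y^2 d_y) > 0 for all c affine
  in y, and sum_y c_y^2 d_y > 0 for affine c not vanishing on all lines, so at most one d_y is 0. The free
  parameters move e_y along the direction w_y of second divided differences and f_y arbitrarily with
  constant sum. If all d_y > 0, they can be chosen with d_y f_y = e_y^2 on every line (k atoms each, by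
  Gaussian quadrature). If one d_y = 0, they can be chosen with e_y = f_y = 0 on that line (k - 1 atoms),
  d f = e^2 on a second one (k atoms) and d f > e^2 on the third (k + 1 atoms). Both ways there are
  3k = rank M_k atoms.
*)
theory Submission
  imports
    Defs
    "HOL-Computational_Algebra.Fundamental_Theorem_Algebra"
begin

section \<open>The truncated moment functional on a line\<close>

definition mom :: "(nat \<Rightarrow> real) \<Rightarrow> real poly \<Rightarrow> real" where
  "mom m p = (\<Sum>i\<le>degree p. coeff p i * m i)"

text \<open>Unlike \<open>degree p < n\<close>, this holds of the zero polynomial also for \<open>n = 0\<close>.\<close>

definition deg_lt :: "nat \<Rightarrow> real poly \<Rightarrow> bool" where
  "deg_lt n p \<longleftrightarrow> (\<forall>i\<ge>n. coeff p i = 0)"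

text \<open>Equivalently, the \<open>n\<close> x \<open>n\<close> Hankel matrix of \<open>m\<close>
  is positive definite; only the moments up to degree \<open>2 * n - 2\<close> enter.\<close>

definition posdef_below :: "nat \<Rightarrow> (nat \<Rightarrow> real) \<Rightarrow> bool" where
  "posdef_below n m \<longleftrightarrow> (\<forall>q. deg_lt n q \<and> q \<noteq> 0 \<longrightarrow> 0 < mom m (q * q))"

definition orth_below :: "nat \<Rightarrow> (nat \<Rightarrow> real) \<Rightarrow> real poly \<Rightarrow> bool" where
  "orth_below n m p \<longleftrightarrow> (\<forall>r. deg_lt n r \<longrightarrow> mom m (p * r) = 0)"

lemma mom_eq_sum:
  assumes "degree p \<le> N"
  shows "mom m p = (\<Sum>i\<le>N. coeff p i * m i)"
  unfolding mom_def
  by (rule sum.mono_neutral_left) (use assms in \<open>auto simp: coeff_eq_0\<close>)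

lemma mom_0 [simp]: "mom m 0 = 0"
  by (simp add: mom_def)

lemma mom_add: "mom m (p + q) = mom m p + mom m q"
proof -
  define N where "N = max (degree p) (degree q)"
  have "degree (p + q) \<le> N" "degree p \<le> N" "degree q \<le> N"
    by (auto simp: N_def intro: degree_add_le_max)
  then show ?thesis
    by (simp add: mom_eq_sum[of _ N] distrib_right sum.distrib)
qed

lemma mom_smult: "mom m (Polynomial.smult c p) = c * mom m p"
proof -
  have "degree (Polynomial.smult c p) \<le> degree p" by simp
  then show ?thesis
    by (simp add: mom_eq_sum[of _ "degree p"] sum_distrib_left mult.assoc)
qed

lemma mom_diff: "mom m (p - q) = mom m p - mom m q"
  using mom_add[of m "p - q" q] by simp

lemma mom_sum: "mom m (sum f A) = (\<Sum>x\<in>A. mom m (f x))"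
  by (induction A rule: infinite_finite_induct) (auto simp: mom_add)

lemma mom_monom: "mom m (monom c i) = c * m i"
proof -
  have "mom m (monom c i) = (\<Sum>j\<le>i. coeff (monom c i) j * m j)"
    by (rule mom_eq_sum) (rule degree_monom_le)
  also have "\<dots> = (\<Sum>j\<le>i. if i = j then c * m i else 0)"
    by (rule sum.cong) auto
  finally show ?thesis by simp
qed

lemma deg_lt_iff: "deg_lt n p \<longleftrightarrow> p = 0 \<or> degree p < n"
proof
  assume *: "deg_lt n p"
  show "p = 0 \<or> degree p < n"
  proof (rule ccontr)
    assume "\<not> ?thesis"
    then have "coeff p (degree p) = 0" using * by (simp add: deg_lt_def)
    with \<open>\<not> ?thesis\<close> show False by simp
  qed
qed (auto simp: deg_lt_def coeff_eq_0)

lemma deg_lt_Suc: "deg_lt (Suc n) p \<longleftrightarrow> degree p \<le> n"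
  by (auto simp: deg_lt_iff)

lemma deg_lt_mono: "deg_lt n p \<Longrightarrow> n \<le> n' \<Longrightarrow> deg_lt n' p"
  by (auto simp: deg_lt_def)

lemma deg_lt_add [intro]: "deg_lt n p \<Longrightarrow> deg_lt n q \<Longrightarrow> deg_lt n (p + q)"
  and deg_lt_smult [intro]: "deg_lt n p \<Longrightarrow> deg_lt n (Polynomial.smult c p)"
  and deg_lt_0 [simp]: "deg_lt n 0"
  by (auto simp: deg_lt_def)

lemma deg_lt_mult:
  assumes "deg_lt a p" "deg_lt b q"
  shows "deg_lt (a + b - 1) (p * q)"
proof (cases "p = 0 \<or> q = 0")
  case False
  then have "degree p < a" "degree q < b" using assms by (auto simp: deg_lt_iff)
  then show ?thesis using degree_mult_le[of p q] by (auto simp: deg_lt_iff)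
qed auto

lemma deg_lt_reduce:
  assumes "deg_lt (Suc n) q" "degree p = n" "coeff p n = 1"
  shows "deg_lt n (q - Polynomial.smult (coeff q n) p)"
  unfolding deg_lt_def
proof (intro allI impI)
  fix i assume "n \<le> i"
  then consider "i = n" | "i \<ge> Suc n" by linarith
  then show "coeff (q - Polynomial.smult (coeff q n) p) i = 0"
    using assms by cases (auto simp: deg_lt_def coeff_eq_0)
qed

lemma monic_sub_deg_lt:
  fixes q :: "real poly"
  assumes "deg_lt n q"
  shows "degree (monom 1 n - q) = n" "coeff (monom 1 n - q) n = 1"
proof -
  show 1: "coeff (monom 1 n - q) n = 1" using assms by (simp add: deg_lt_def)
  have "degree (monom 1 n - q) \<le> n"
    using assms by (intro degree_le) (auto simp: deg_lt_def)
  then show "degree (monom 1 n - q) = n"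
    using le_degree[of "monom 1 n - q" n] 1 by simp
qed

lemma orth_below_diff: "orth_below n m p \<Longrightarrow> orth_below n m q \<Longrightarrow> orth_below n m (p - q)"
  and orth_below_smult: "orth_below n m p \<Longrightarrow> orth_below n m (Polynomial.smult c p)"
  by (auto simp: orth_below_def mom_add mom_diff mom_smult algebra_simps)

lemma orth_belowD: "orth_below n m p \<Longrightarrow> deg_lt n r \<Longrightarrow> mom m (p * r) = 0"
  by (simp add: orth_below_def)

lemma posdef_belowD: "posdef_below n m \<Longrightarrow> deg_lt n q \<Longrightarrow> q \<noteq> 0 \<Longrightarrow> 0 < mom m (q * q)"
  by (simp add: posdef_below_def)

lemma posdef_below_mono: "posdef_below n m \<Longrightarrow> n' \<le> n \<Longrightarrow> posdef_below n' m"
  by (auto simp: posdef_below_def intro: deg_lt_mono)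

text \<open>Modulo a multiple of \<open>g\<close>, a test polynomial of degree \<open>n\<close>
  drops to lower degree, so one further test suffices. Any monic polynomial of the right degree may
  serve as that test; below these are \<open>g\<close>, \<open>h\<close> and
  \<open>pCons 0 h\<close>.\<close>

lemma orth_below_Suc:
  assumes orth: "orth_below n m P" and g: "degree g = n" "coeff g n = 1" "mom m (P * g) = 0"
  shows "orth_below (Suc n) m P"
  unfolding orth_below_def
proof (intro allI impI)
  fix q assume q: "deg_lt (Suc n) q"
  define r where "r = q - Polynomial.smult (coeff q n) g"
  have "deg_lt n r" unfolding r_def by (rule deg_lt_reduce[OF q g(1,2)])
  moreover have "P * q = Polynomial.smult (coeff q n) (P * g) + P * r" by (simp add: r_def algebra_simps)
  ultimately show "mom m (P * q) = 0"
    using g(3) orth_belowD[OF orth] by (simp add: mom_add mom_smult)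
qed

text \<open>The splitting of \<open>q\<close> into a multiple of \<open>g\<close> and a remainder of
  lower degree is orthogonal, so the form becomes a sum of two nonnegative terms that cannot both
  vanish.\<close>

lemma posdef_below_Suc:
  assumes pd: "posdef_below n m" and g: "degree g = n" "coeff g n = 1"
    and orth: "orth_below n m g" and pos: "0 < mom m (g * g)"
  shows "posdef_below (Suc n) m"
  unfolding posdef_below_def
proof (intro allI impI, elim conjE)
  fix q :: "real poly" assume q: "deg_lt (Suc n) q" "q \<noteq> 0"
  define c where "c = coeff q n"
  define r where "r = q - Polynomial.smult c g"
  have r: "deg_lt n r" unfolding r_def c_def by (rule deg_lt_reduce[OF q(1) g])
  have "q = Polynomial.smult c g + r" by (simp add: r_def)
  then have "q * q = Polynomial.smult (c * c) (g * g) + Polynomial.smult c (g * r)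
      + Polynomial.smult c (g * r) + r * r"
    by (simp add: algebra_simps)
  then have *: "mom m (q * q) = c * c * mom m (g * g) + mom m (r * r)"
    using orth_belowD[OF orth r] by (simp only: mom_add mom_smult)
  show "0 < mom m (q * q)"
  proof (cases "r = 0")
    case True
    then have "c \<noteq> 0" using q by (auto simp: r_def)
    then have "0 < c * c" by (metis not_real_square_gt_zero)
    then have "0 < c * c * mom m (g * g)" using pos by simp
    with True show ?thesis by (simp add: *)
  next
    case False
    then have "0 < mom m (r * r)" using pd r by (simp add: posdef_belowD)
    moreover have "0 \<le> c * c * mom m (g * g)" using pos by simp
    ultimately show ?thesis by (simp add: *)
  qed
qed

text \<open>Gram-Schmidt. Applied to monomials, this is the source of all monic orthogonal
  polynomials used below.\<close>

lemma exists_orth_projection: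
  assumes "posdef_below n m"
  shows "\<exists>q. deg_lt n q \<and> orth_below n m (f - q)"
  using assms
proof (induction n arbitrary: f)
  case 0
  show ?case by (rule exI[of _ 0]) (auto simp: orth_below_def deg_lt_iff)
next
  case (Suc n)
  have pd: "posdef_below n m" using Suc.prems by (rule posdef_below_mono) simp
  obtain q where q: "deg_lt n q" "orth_below n m (f - q)" using Suc.IH[OF pd] by blast
  \<comment> \<open>Projecting \<open>X^n\<close> itself yields the orthogonal polynomial
    \<open>P\<close> of degree \<open>n\<close>, the new basis vector.\<close>
  obtain s where s: "deg_lt n s" "orth_below n m (monom 1 n - s)" using Suc.IH[OF pd] by blast
  define P where "P = monom 1 n - s"
  have P: "degree P = n" "coeff P n = 1" unfolding P_def using monic_sub_deg_lt[OF s(1)] by auto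
  have "P \<noteq> 0" using P by auto
  then have pos: "0 < mom m (P * P)"
    using P Suc.prems by (auto intro!: posdef_belowD simp: deg_lt_iff)
  \<comment> \<open>The Fourier coefficient of \<open>f - q\<close> along \<open>P\<close>.\<close>
  define c where "c = mom m ((f - q) * P) / mom m (P * P)"
  have orth: "orth_below n m (f - (q + Polynomial.smult c P))"
    unfolding diff_add_eq_diff_diff_swap[symmetric]
    using q(2) s(2) orth_below_diff orth_below_smult
    by (metis P_def diff_diff_eq)
  have "(f - (q + Polynomial.smult c P)) * P = (f - q) * P - Polynomial.smult c (P * P)" by (simp add: algebra_simps)
  then have "mom m ((f - (q + Polynomial.smult c P)) * P) = 0"
    using pos by (simp add: mom_diff mom_smult c_def)
  then have "orth_below (Suc n) m (f - (q + Polynomial.smult c P))"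
    using orth_below_Suc[OF orth P] by blast
  moreover have "deg_lt (Suc n) (q + Polynomial.smult c P)"
    using deg_lt_mono[OF q(1), of "Suc n"] P by (intro deg_lt_add deg_lt_smult) (auto simp: deg_lt_Suc)
  ultimately show ?case by blast
qed

section \<open>Gaussian quadrature\<close>

definition lagrange :: "real set \<Rightarrow> real \<Rightarrow> real poly" where
  "lagrange Z z = Polynomial.smult (1 / (\<Prod>w\<in>Z - {z}. z - w)) (\<Prod>w\<in>Z - {z}. [:- w, 1:])"

lemma degree_prod_linear:
  "finite Z \<Longrightarrow> degree (\<Prod>z\<in>Z. [:- z, 1:] :: real poly) = card Z"
  by (subst degree_prod_eq_sum_degree) auto

lemma lead_coeff_prod_linear: "lead_coeff (\<Prod>z\<in>Z. [:- z, 1:] :: real poly) = 1"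
  by (simp add: lead_coeff_prod)

lemma lagrange_denom_nonzero: "finite Z \<Longrightarrow> (\<Prod>w\<in>Z - {z}. z - w) \<noteq> (0::real)"
  by (auto simp: prod_zero_iff)

lemma degree_lagrange: "finite Z \<Longrightarrow> z \<in> Z \<Longrightarrow> degree (lagrange Z z) = card Z - 1"
  using lagrange_denom_nonzero[of Z z] by (simp add: lagrange_def degree_prod_linear)

lemma lead_coeff_lagrange: "finite Z \<Longrightarrow> z \<in> Z \<Longrightarrow> coeff (lagrange Z z) (card Z - 1) \<noteq> 0"
  using degree_lagrange[of Z z] lagrange_denom_nonzero[of Z z]
    lead_coeff_prod_linear[of "Z - {z}"]
  by (metis divide_eq_0_iff lagrange_def leading_coeff_0_iff mult_eq_0_iff smult_eq_0_iff zero_neq_one)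

lemma poly_lagrange:
  assumes "finite Z" "w \<in> Z"
  shows "poly (lagrange Z z) w = (if w = z then 1 else 0)"
proof (cases "w = z")
  case True
  then show ?thesis
    using lagrange_denom_nonzero[OF assms(1), of z] by (simp add: lagrange_def poly_prod)
next
  case False
  then have "(\<Prod>v\<in>Z - {z}. poly [:- v, 1:] w) = 0"
    using assms by (intro prod_zero) auto
  then show ?thesis using False by (simp add: lagrange_def poly_prod)
qed

lemma lagrange_interpolation:
  assumes Z: "finite Z" and q: "deg_lt (card Z) q"
  shows "q = (\<Sum>z\<in>Z. Polynomial.smult (poly q z) (lagrange Z z))"
proof (cases "Z = {}")
  case True
  with q show ?thesis by (simp add: deg_lt_def poly_eq_iff)
next
  case False
  show ?thesis
  proof (rule poly_eqI_degree[of Z])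
    fix w assume "w \<in> Z"
    then show "poly q w = poly (\<Sum>z\<in>Z. Polynomial.smult (poly q z) (lagrange Z z)) w"
      using Z by (simp add: poly_sum poly_lagrange if_distrib cong: if_cong)
  next
    show "degree q < card Z" using q False Z by (auto simp: deg_lt_iff card_gt_0_iff)
    have "degree (\<Sum>z\<in>Z. Polynomial.smult (poly q z) (lagrange Z z)) \<le> card Z - 1"
      using Z by (intro degree_sum_le) (auto simp: degree_lagrange intro: order.trans[OF degree_smult_le])
    moreover have "0 < card Z" using False Z by (simp add: card_gt_0_iff)
    ultimately show "degree (\<Sum>z\<in>Z. Polynomial.smult (poly q z) (lagrange Z z)) < card Z" by linarith
  qed
qed

section \<open>Factorisation of real polynomials through their complex roots\<close>

lemma map_poly_of_real_add:
  "map_poly complex_of_real (p + q) = map_poly complex_of_real p + map_poly complex_of_real q"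
  by (rule poly_eqI) (simp add: coeff_map_poly)

lemma map_poly_of_real_mult:
  "map_poly complex_of_real (p * q) = map_poly complex_of_real p * map_poly complex_of_real q"
  by (rule poly_eqI) (simp add: coeff_map_poly coeff_mult)

lemma poly_map_poly_of_real:
  "poly (map_poly complex_of_real p) (of_real x) = of_real (poly p x)"
  by (induction p) (auto simp: map_poly_pCons)

text \<open>The divisor is \<open>(X - w) (X - cnj w)\<close>. The remainder modulo it is a real
  polynomial of degree at most 1 that vanishes at a nonreal point, hence zero.\<close>

lemma nonreal_root_imp_quadratic_factor:
  fixes p :: "real poly"
  assumes root: "poly (map_poly complex_of_real p) w = 0" and "Im w \<noteq> 0"
  shows "[:(Re w)\<^sup>2 + (Im w)\<^sup>2, - 2 * Re w, 1:] dvd p"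
proof -
  define D :: "real poly" where "D = [:(Re w)\<^sup>2 + (Im w)\<^sup>2, - 2 * Re w, 1:]"
  define r where "r = p mod D"
  have D: "degree D = 2" "D \<noteq> 0" by (auto simp: D_def)
  have "r = 0 \<or> degree r < 2" unfolding r_def using degree_mod_less[of D p] D by simp
  then have r: "r = [:coeff r 0, coeff r 1:]"
    by (auto simp: poly_eq_iff coeff_pCons coeff_eq_0 split: nat.split)
  have "poly (map_poly complex_of_real D) w = 0"
    by (simp add: D_def complex_eq_iff power2_eq_square map_poly_pCons algebra_simps)
  moreover have "p = D * (p div D) + r" by (simp add: r_def)
  then have "map_poly complex_of_real p =
      map_poly complex_of_real D * map_poly complex_of_real (p div D) + map_poly complex_of_real r"
    by (metis map_poly_of_real_add map_poly_of_real_mult)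
  ultimately have "poly (map_poly complex_of_real r) w = 0" using root by simp
  then have "poly (map_poly complex_of_real [:coeff r 0, coeff r 1:]) w = 0" using r by simp
  then have "coeff r 0 + Re w * coeff r 1 = 0" "Im w * coeff r 1 = 0"
    by (auto simp: complex_eq_iff map_poly_pCons)
  then have "coeff r 1 = 0" "coeff r 0 = 0" using assms(2) by auto
  then have "r = 0" using r by simp
  then show ?thesis by (simp add: r_def D_def mod_eq_0_iff_dvd)
qed

text \<open>The excluded factor is \<open>(X - a)^2 + b^2\<close>: with \<open>b\<close> nonzero
  this rules out nonreal roots, with \<open>b = 0\<close> multiple real roots.\<close>

lemma splits_into_distinct_linear:
  fixes p :: "real poly"
  assumes "lead_coeff p = 1"
    and "\<And>a b R. p \<noteq> [:a\<^sup>2 + b\<^sup>2, - 2 * a, 1:] * R"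
  shows "\<exists>Z. finite Z \<and> card Z = degree p \<and> p = (\<Prod>z\<in>Z. [:- z, 1:])"
  using assms
proof (induction "degree p" arbitrary: p)
  case 0
  then have "p = 1" by (metis degree_0_id one_pCons)
  then show ?case by (intro exI[of _ "{}"]) auto
next
  case (Suc n)
  have "\<exists>w. poly (map_poly complex_of_real p) w = 0"
    using Suc.hyps(2) by (intro fundamental_theorem_of_algebra) (simp add: constant_degree degree_map_poly)
  then obtain w where w: "poly (map_poly complex_of_real p) w = 0" by blast
  have "Im w = 0" 
    using nonreal_root_imp_quadratic_factor[OF w] Suc.prems(2) by (metis dvdE)
  then have "poly p (Re w) = 0"
    using w by (metis complex_is_Real_iff of_real_Re of_real_eq_0_iff poly_map_poly_of_real)
  then obtain q where q: "p = [:- Re w, 1:] * q" by (auto simp: poly_eq_0_iff_dvd elim!: dvdE)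
  then have "q \<noteq> 0" using Suc.prems(1) by auto
  have "degree q = n" using Suc.hyps(2) q \<open>q \<noteq> 0\<close> by (simp add: degree_mult_eq del: mult_pCons_left)
  moreover have "lead_coeff q = 1" using Suc.prems(1) by (simp add: q lead_coeff_mult del: mult_pCons_left)
  moreover have "q \<noteq> [:a\<^sup>2 + b\<^sup>2, - 2 * a, 1:] * R" for a b R
    using Suc.prems(2)[of a b "[:- Re w, 1:] * R"] unfolding q by (metis mult.left_commute)
  ultimately obtain Z where Z: "finite Z" "card Z = n" "q = (\<Prod>z\<in>Z. [:- z, 1:])"
    using Suc.hyps(1)[of q] by blast
  have "Re w \<notin> Z"
  proof
    assume "Re w \<in> Z"
    then have "q = [:- Re w, 1:] * (\<Prod>z\<in>Z - {Re w}. [:- z, 1:])"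
      using Z prod.remove by metis
    \<comment> \<open>A repeated root produces the excluded factor with
      \<open>b = 0\<close>.\<close>
    then have "p = [:(Re w)\<^sup>2 + 0\<^sup>2, - 2 * Re w, 1:] * (\<Prod>z\<in>Z - {Re w}. [:- z, 1:])"
      unfolding q by (simp only: mult.assoc[symmetric]) (simp add: power2_eq_square)
    then show False using Suc.prems(2) by blast
  qed
  then show ?case using Z Suc.hyps(2) q by (intro exI[of _ "insert (Re w) Z"]) auto
qed

text \<open>Division by \<open>P\<close> reduces degree below \<open>n + D\<close> to degree below
  \<open>n\<close>: the quotient has degree below \<open>D\<close> and is annihilated by
  orthogonality, and the remainder is integrated exactly by interpolation at the roots of
  \<open>P\<close>. Squared Lagrange polynomials isolate single weights and show that they are
  positive. For \<open>D = n\<close> this is the classical rule; a larger \<open>D\<close> expresses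
  a degenerate functional, for which the same nodes reproduce more moments.\<close>

lemma gauss_quadrature:
  assumes pd: "posdef_below n m" and P: "degree P = n" "coeff P n = 1"
    and orth: "orth_below D m P" and "n \<le> D"
  shows "\<exists>Z \<rho>. finite Z \<and> card Z = n \<and> (\<forall>z\<in>Z. 0 < \<rho> z) \<and>
    (\<forall>i<n + D. m i = (\<Sum>z\<in>Z. \<rho> z * z ^ i))"
proof -
  \<comment> \<open>If \<open>P\<close> had a nonreal or a multiple root, it would have such a quadratic factor and \<open>P * R\<close>
    would be a sum of squares.\<close>
  have no_square: "P \<noteq> [:a\<^sup>2 + b\<^sup>2, - 2 * a, 1:] * R" for a b R
  proof
    assume eq: "P = [:a\<^sup>2 + b\<^sup>2, - 2 * a, 1:] * R"
    then have R: "R \<noteq> 0" using P by auto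
    then have deg: "degree R + 2 = n"
      using P(1) unfolding eq by (subst (asm) degree_mult_eq) auto
    then have R': "deg_lt n R" "deg_lt n ([:- a, 1:] * R)"
      using R by (auto simp: deg_lt_iff degree_mult_eq simp del: mult_pCons_left)
    have "P = ([:- a, 1:] * [:- a, 1:] + [:b\<^sup>2:]) * R"
      unfolding eq by (simp add: power2_eq_square)
    then have "P * R = ([:- a, 1:] * R) * ([:- a, 1:] * R) + Polynomial.smult (b\<^sup>2) (R * R)"
      by (simp add: algebra_simps del: mult_pCons_left mult_pCons_right) simp
    moreover have "mom m (P * R) = 0"
      using R'(1) \<open>n \<le> D\<close> deg_lt_mono by (blast intro: orth_belowD[OF orth])
    moreover have "0 < mom m (([:- a, 1:] * R) * ([:- a, 1:] * R))"
      by (rule posdef_belowD[OF pd R'(2)]) (use R in \<open>simp del: mult_pCons_left\<close>)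
    moreover have "0 \<le> b\<^sup>2 * mom m (R * R)"
      using posdef_belowD[OF pd R'(1)] R by simp
    ultimately show False by (simp add: mom_add mom_smult)
  qed
  obtain Z where Z: "finite Z" "card Z = n" "P = (\<Prod>z\<in>Z. [:- z, 1:])"
    using splits_into_distinct_linear[OF _ no_square] P by metis
  \<comment> \<open>The Christoffel numbers: exactness on the Lagrange basis forces these
    weights.\<close>
  define \<rho> where "\<rho> z = mom m (lagrange Z z)" for z
  have low: "mom m q = (\<Sum>z\<in>Z. \<rho> z * poly q z)" if "deg_lt n q" for q
    using arg_cong[OF lagrange_interpolation[OF Z(1), of q], of "mom m"] that Z(2)
    by (simp add: mom_sum mom_smult \<rho>_def mult.commute)
  have root: "poly P z = 0" if "z \<in> Z" for z
    using that Z by (auto simp: poly_prod)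
  have quad: "mom m q = (\<Sum>z\<in>Z. \<rho> z * poly q z)" if "deg_lt (n + D) q" for q
  proof -
    have "P \<noteq> 0" using P by auto
    have "deg_lt n (q mod P)" using degree_mod_less[OF \<open>P \<noteq> 0\<close>, of q] P by (auto simp: deg_lt_iff)
    moreover have "deg_lt D (q div P)"
    proof (cases "q div P = 0")
      case False
      have "degree q = degree (P * (q div P))"
      proof (cases "q mod P = 0")
        case False
        have "degree (q mod P) < degree (P * (q div P))"
          using degree_mod_less[OF \<open>P \<noteq> 0\<close>, of q] False \<open>q div P \<noteq> 0\<close> \<open>P \<noteq> 0\<close>
          by (simp add: degree_mult_eq)
        then show ?thesis by (metis degree_add_eq_left mult_div_mod_eq)
      qed (metis add.right_neutral mult_div_mod_eq)
      then have "degree q = n + degree (q div P)"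
        using False \<open>P \<noteq> 0\<close> P by (simp add: degree_mult_eq)
      moreover have "q \<noteq> 0" using False by auto
      ultimately show ?thesis using that by (auto simp: deg_lt_iff)
    qed simp
    moreover have "mom m q = mom m (P * (q div P)) + mom m (q mod P)"
      by (metis mom_add mult_div_mod_eq)
    ultimately have "mom m q = (\<Sum>z\<in>Z. \<rho> z * poly (q mod P) z)"
      using orth low by (simp add: orth_belowD)
    moreover have "poly (q mod P) z = poly q z" if "z \<in> Z" for z
      by (metis add.left_neutral mult_div_mod_eq mult_zero_left poly_add poly_mult root that)
    ultimately show ?thesis by (simp cong: sum.cong)
  qed
  have "0 < \<rho> z" if z: "z \<in> Z" for z
  proof -
    have n: "0 < n" using z Z by (auto simp: card_gt_0_iff)
    have lt: "deg_lt n (lagrange Z z)"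
      using degree_lagrange[OF Z(1) z] Z(2) n by (simp add: deg_lt_iff)
    have "lagrange Z z \<noteq> 0" using poly_lagrange[OF Z(1) z, of z] by auto
    then have "0 < mom m (lagrange Z z * lagrange Z z)" using posdef_belowD[OF pd lt] by simp
    also have "\<dots> = (\<Sum>w\<in>Z. \<rho> w * poly (lagrange Z z * lagrange Z z) w)"
      using deg_lt_mult[OF lt lt] \<open>n \<le> D\<close> by (intro quad) (auto intro: deg_lt_mono)
    also have "\<dots> = (\<Sum>w\<in>Z. if w = z then \<rho> z else 0)"
      by (rule sum.cong) (auto simp: poly_lagrange Z)
    finally show ?thesis using Z(1) z by simp
  qed
  moreover have "m i = (\<Sum>z\<in>Z. \<rho> z * z ^ i)" if "i < n + D" for i
    using quad[of "monom 1 i"] that degree_monom_le[of "1::real" i]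
    by (auto simp: mom_monom poly_monom deg_lt_iff)
  ultimately show ?thesis using Z by blast
qed

text \<open>\<open>N\<close> is the number of moments, not their degree: \<open>2 * n + 3\<close>
  below covers the degrees up to \<open>2 * n + 2\<close>, which is \<open>2 * k\<close> for
  \<open>n = k - 1\<close>.\<close>

definition atomic_upto :: "nat \<Rightarrow> (nat \<Rightarrow> real) \<Rightarrow> nat \<Rightarrow> bool" where
  "atomic_upto N m c \<longleftrightarrow> (\<exists>Z \<rho>. finite Z \<and> card Z = c \<and> (\<forall>z\<in>Z. 0 < \<rho> z) \<and>
     (\<forall>i<N. m i = (\<Sum>z\<in>Z. \<rho> z * z ^ i)))"

lemma atomic_upto_mono: "atomic_upto N m c \<Longrightarrow> N' \<le> N \<Longrightarrow> atomic_upto N' m c"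
  unfolding atomic_upto_def by (blast intro: order_less_le_trans)

section \<open>Truncated moment sequences on a line\<close>

text \<open>The numbers \<open>d\<close>, \<open>e\<close>, \<open>f\<close> below form the Gram
  matrix of \<open>g\<close> and \<open>h\<close>. Up to a change of basis it is the Schur
  complement of the leading \<open>n\<close> x \<open>n\<close> block in the Hankel matrix of order
  \<open>n + 2\<close>, and its shape decides the number of atoms.\<close>

locale line =
  fixes n :: nat and m :: "nat \<Rightarrow> real" and g h :: "real poly"
  assumes pd: "posdef_below n m"
    and g: "degree g = n" "coeff g n = 1" "orth_below n m g"
    and h: "degree h = Suc n" "coeff h (Suc n) = 1" "orth_below n m h"
begin

abbreviation "d \<equiv> mom m (g * g)"
abbreviation "e \<equiv> mom m (h * g)"
abbreviation "f \<equiv> mom m (h * h)"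

text \<open>With a vanishing Gram matrix, \<open>g\<close> and \<open>h\<close> are orthogonal to
  all degrees up to \<open>n + 1\<close>. Moving a factor \<open>X\<close> from \<open>h\<close> to
  \<open>g\<close> gains one more degree for \<open>g\<close>, so its \<open>n\<close> roots carry a
  rule that is exact on \<open>n + (n + 3)\<close> moments.\<close>

lemma atomic_singular:
  assumes "d = 0" "e = 0" "f = 0"
  shows "atomic_upto (2 * n + 3) m n"
proof -
  have g': "orth_below (Suc n) m g"
    by (rule orth_below_Suc[OF g(3) g(1,2)]) (use assms in simp)
  then have g'': "orth_below (Suc (Suc n)) m g"
    by (rule orth_below_Suc[OF _ h(1,2)]) (use assms in \<open>simp add: mult.commute\<close>)
  have "orth_below (Suc n) m h"
    by (rule orth_below_Suc[OF h(3) g(1,2)]) (use assms in simp)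
  then have h'': "orth_below (Suc (Suc n)) m h"
    by (rule orth_below_Suc[OF _ h(1,2)]) (use assms in simp)
  have xg: "deg_lt (Suc (Suc n)) (pCons 0 g)"
    using g by (simp add: deg_lt_iff)
  have "orth_below (Suc (Suc (Suc n))) m g"
  proof (rule orth_below_Suc[OF g''])
    show "degree (pCons 0 h) = Suc (Suc n)" using h by (auto simp: degree_pCons_eq)
    show "coeff (pCons 0 h) (Suc (Suc n)) = 1" using h by simp
    have "g * pCons 0 h = h * pCons 0 g" by (simp add: mult.commute)
    then show "mom m (g * pCons 0 h) = 0" using orth_belowD[OF h'' xg] by (simp only:)
  qed
  from gauss_quadrature[OF pd g(1,2) this] have "atomic_upto (n + Suc (Suc (Suc n))) m n"
    unfolding atomic_upto_def by simp
  then show ?thesis by (rule atomic_upto_mono) simp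
qed

lemma pd_Suc: "0 < d \<Longrightarrow> posdef_below (Suc n) m"
  using posdef_below_Suc[OF pd g] .

text \<open>Removing from \<open>h\<close> its component along \<open>g\<close> leaves the
  orthogonal polynomial of degree \<open>n + 1\<close>. Its squared norm is the determinant of the
  Gram matrix divided by \<open>d\<close>.\<close>

lemma next_orth:
  defines "P \<equiv> h - Polynomial.smult (e / d) g"
  assumes "0 < d"
  shows "degree P = Suc n" "coeff P (Suc n) = 1" "orth_below (Suc n) m P"
    and "mom m (P * P) = f - e\<^sup>2 / d"
proof -
  show P1: "coeff P (Suc n) = 1" using g h by (simp add: P_def coeff_eq_0)
  have "degree P \<le> Suc n"
    using g h unfolding P_def by (intro degree_diff_le) (auto intro: order.trans[OF degree_smult_le])
  with P1 show P2: "degree P = Suc n" using le_degree[of P "Suc n"] by simp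
  have "P * g = h * g - Polynomial.smult (e / d) (g * g)" by (simp add: P_def algebra_simps)
  then have Pg: "mom m (P * g) = 0" using assms by (simp add: mom_diff mom_smult)
  have "orth_below n m P" unfolding P_def by (intro orth_below_diff orth_below_smult g h)
  from orth_below_Suc[OF this g(1,2) Pg] show orth: "orth_below (Suc n) m P" .
  have "P * P = P * h - Polynomial.smult (e / d) (P * g)"
    by (subst (2) P_def) (simp add: right_diff_distrib)
  moreover have "P * h = h * h - Polynomial.smult (e / d) (h * g)" by (simp add: P_def algebra_simps)
  ultimately show "mom m (P * P) = f - e\<^sup>2 / d"
    using Pg by (simp add: mom_diff mom_smult power2_eq_square)
qed

text \<open>The next orthogonal polynomial has norm zero and is therefore orthogonal to its own
  degree as well; its \<open>n + 1\<close> roots reproduce \<open>(n + 1) + (n + 2)\<close>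
  moments.\<close>

lemma atomic_tight:
  assumes "0 < d" "d * f = e\<^sup>2"
  shows "atomic_upto (2 * n + 3) m (Suc n)"
proof -
  let ?P = "h - Polynomial.smult (e / d) g"
  note P = next_orth[OF assms(1)]
  have "mom m (?P * ?P) = 0" using assms unfolding P(4) by (simp add: field_simps)
  then have "orth_below (Suc (Suc n)) m ?P"
    by (rule orth_below_Suc[OF P(3,1,2)])
  from gauss_quadrature[OF pd_Suc[OF assms(1)] P(1,2) this]
  have "atomic_upto (Suc n + Suc (Suc n)) m (Suc n)" unfolding atomic_upto_def by simp
  then show ?thesis by (rule atomic_upto_mono) simp
qed

lemma atomic_slack:
  assumes "0 < d" "e\<^sup>2 < d * f"
  shows "atomic_upto (2 * n + 3) m (Suc (Suc n))"
proof -
  let ?P = "h - Polynomial.smult (e / d) g"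
  note P = next_orth[OF assms(1)]
  have "0 < mom m (?P * ?P)" using assms unfolding P(4) by (simp add: field_simps)
  then have pd2: "posdef_below (Suc (Suc n)) m"
    by (rule posdef_below_Suc[OF pd_Suc[OF assms(1)] P(1,2,3)])
  \<comment> \<open>This projection also involves \<open>m (2 * n + 3)\<close>, whatever its value;
    the resulting rule reproduces that moment too, one more than is claimed.\<close>
  obtain q where q: "deg_lt (Suc (Suc n)) q" "orth_below (Suc (Suc n)) m (monom 1 (Suc (Suc n)) - q)"
    using exists_orth_projection[OF pd2] by blast
  from gauss_quadrature[OF pd2 monic_sub_deg_lt[OF q(1)] q(2)]
  have "atomic_upto (Suc (Suc n) + Suc (Suc n)) m (Suc (Suc n))" unfolding atomic_upto_def by simp
  then show ?thesis by (rule atomic_upto_mono) simp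
qed

end

section \<open>Distributing the free moments over three lines\<close>

definition affine_on :: "real set \<Rightarrow> (real \<Rightarrow> real) \<Rightarrow> bool" where
  "affine_on Y c \<longleftrightarrow> (\<exists>A B. \<forall>y\<in>Y. c y = A + B * y)"

text \<open>On a line with \<open>d > 0\<close> the least admissible \<open>f'\<close> is
  \<open>(e + \<tau> w)^2 / d\<close>. If all \<open>d\<close> are positive, the sum of these bounds
  is a quadratic polynomial in \<open>\<tau>\<close>; at its minimum \<open>e / d\<close> is
  orthogonal to \<open>w\<close>, hence affine, and \<open>pos\<close> shows that the minimum is
  below the sum of \<open>f\<close>, so some \<open>\<tau>\<close> attains that sum. If one
  \<open>d\<close> vanishes, \<open>\<tau>\<close> is spent on clearing \<open>e\<close> on that
  line, and \<open>pos\<close> leaves room on the other two. The number \<open>s y\<close> counts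
  atoms in excess of \<open>k - 1\<close>.\<close>

lemma choose_parameters:
  fixes d e f w :: "real \<Rightarrow> real"
  assumes Y: "finite Y" "card Y = 3"
    and d: "\<And>y. y \<in> Y \<Longrightarrow> 0 \<le> d y"
    and w: "\<And>y. y \<in> Y \<Longrightarrow> w y \<noteq> 0"
    and w_affine: "\<And>c. affine_on Y c \<longleftrightarrow> (\<Sum>y\<in>Y. w y * c y) = 0"
    and pos: "\<And>c. affine_on Y c \<Longrightarrow> 0 < (\<Sum>y\<in>Y. f y + 2 * c y * e y + c y * c y * d y)"
    and pos': "\<And>c. affine_on Y c \<Longrightarrow> \<exists>y\<in>Y. c y \<noteq> 0 \<Longrightarrow> 0 < (\<Sum>y\<in>Y. c y * c y * d y)"
  shows "\<exists>\<tau> f' (s :: real \<Rightarrow> nat). sum f' Y = sum f Y \<and> sum s Y = 3 \<and>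
    (\<forall>y\<in>Y. d y = 0 \<and> e y + \<tau> * w y = 0 \<and> f' y = 0 \<and> s y = 0 \<or>
      0 < d y \<and> d y * f' y = (e y + \<tau> * w y)\<^sup>2 \<and> s y = 1 \<or>
      0 < d y \<and> (e y + \<tau> * w y)\<^sup>2 < d y * f' y \<and> s y = 2)"
proof -
  \<comment> \<open>Since \<open>w\<close> is orthogonal to affine functions, moving
    \<open>e\<close> along \<open>w\<close> does not change the form at an affine
    \<open>c\<close>.\<close>
  have shift: "0 < sum f Y + (\<Sum>y\<in>Y. 2 * c y * (e y + \<tau> * w y) + c y * c y * d y)"
    if "affine_on Y c" for c \<tau>
  proof -
    have "(\<Sum>y\<in>Y. 2 * c y * (e y + \<tau> * w y) + c y * c y * d y) =
        (\<Sum>y\<in>Y. 2 * c y * e y + c y * c y * d y) + 2 * \<tau> * (\<Sum>y\<in>Y. w y * c y)"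
      by (simp add: sum_distrib_left algebra_simps sum.distrib)
    then show ?thesis using pos[OF that] w_affine[of c] that by (simp add: sum.distrib)
  qed
  show ?thesis
  proof (cases "\<forall>y\<in>Y. 0 < d y")
    case True
    define W where "W = (\<Sum>y\<in>Y. (w y)\<^sup>2 / d y)"
    have "Y \<noteq> {}" using Y by auto
    then have W: "0 < W" unfolding W_def using Y True w by (intro sum_pos) auto
    \<comment> \<open>The minimiser of the sum of \<open>(e + \<tau> w)^2 / d\<close>; the equation
      \<open>we0\<close> is the vanishing of the derivative.\<close>
    define \<tau>0 where "\<tau>0 = - (\<Sum>y\<in>Y. w y * e y / d y) / W"
    define e0 where "e0 y = e y + \<tau>0 * w y" for y
    have "(\<Sum>y\<in>Y. w y * e0 y / d y) = (\<Sum>y\<in>Y. w y * e y / d y) + \<tau>0 * W"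
      by (simp add: e0_def W_def sum_distrib_left sum.distrib power2_eq_square add_divide_distrib algebra_simps)
    also have "\<dots> = 0" using W by (simp add: \<tau>0_def)
    finally have we0: "(\<Sum>y\<in>Y. w y * e0 y / d y) = 0" .
    define D where "D = sum f Y - (\<Sum>y\<in>Y. (e0 y)\<^sup>2 / d y)"
    \<comment> \<open>The choice \<open>c = - e0 / d\<close> minimises the form on every line, and
      \<open>we0\<close> makes it affine.\<close>
    have "affine_on Y (\<lambda>y. - e0 y / d y)"
      unfolding w_affine using we0 by (simp add: sum_negf)
    from shift[OF this, of \<tau>0]
    have "0 < sum f Y + (\<Sum>y\<in>Y. 2 * (- e0 y / d y) * e0 y + (- e0 y / d y) * (- e0 y / d y) * d y)"
      by (simp add: e0_def)
    also have "(\<Sum>y\<in>Y. 2 * (- e0 y / d y) * e0 y + (- e0 y / d y) * (- e0 y / d y) * d y) =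
        (\<Sum>y\<in>Y. - ((e0 y)\<^sup>2 / d y))"
      using True by (intro sum.cong refl) (simp add: field_simps power2_eq_square)
    finally have D: "0 < D" by (simp add: D_def sum_negf)
    \<comment> \<open>At distance \<open>t\<close> from the minimiser the sum has grown by
      \<open>t^2 W\<close>, which has to fill the gap \<open>D\<close>.\<close>
    define t where "t = sqrt (D / W)"
    have t: "t\<^sup>2 * W = D" using D W by (simp add: t_def)
    define f' where "f' y = (e0 y + t * w y)\<^sup>2 / d y" for y
    have "sum f' Y = (\<Sum>y\<in>Y. (e0 y)\<^sup>2 / d y + 2 * t * (w y * e0 y / d y) + t\<^sup>2 * ((w y)\<^sup>2 / d y))"
      by (rule sum.cong) (auto simp: f'_def power2_sum power_mult_distrib add_divide_distrib)
    also have "\<dots> = (\<Sum>y\<in>Y. (e0 y)\<^sup>2 / d y) + 2 * t * (\<Sum>y\<in>Y. w y * e0 y / d y) + t\<^sup>2 * W"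
      by (simp only: sum.distrib sum_distrib_left W_def)
    finally have "sum f' Y = (\<Sum>y\<in>Y. (e0 y)\<^sup>2 / d y) + 2 * t * (\<Sum>y\<in>Y. w y * e0 y / d y) + t\<^sup>2 * W" .
    then have "sum f' Y = sum f Y" by (simp add: we0 t D_def)
    moreover have "d y * f' y = (e y + (\<tau>0 + t) * w y)\<^sup>2" if "y \<in> Y" for y
      using bspec[OF True that] by (simp add: f'_def e0_def algebra_simps)
    ultimately show ?thesis
      using True Y by (intro exI[of _ "\<tau>0 + t"] exI[of _ f'] exI[of _ "\<lambda>_. 1"]) auto
  next
    case False
    then obtain y0 where y0: "y0 \<in> Y" "d y0 = 0" using d by force
    then have "card (Y - {y0}) = 2" using Y by simp
    then obtain y1 y2 where "Y - {y0} = {y1, y2}" "y1 \<noteq> y2" by (meson card_2_iff)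
    then have Y': "Y = {y0, y1, y2}" and ne: "y0 \<noteq> y1" "y0 \<noteq> y2" "y1 \<noteq> y2" using y0 by auto
    \<comment> \<open>A second vanishing \<open>d\<close> would let the affine function that
      vanishes on the remaining line annihilate the form in \<open>pos'\<close>.\<close>
    have "d y1 \<noteq> 0"
    proof
      assume "d y1 = 0"
      moreover have "affine_on Y (\<lambda>y. y - y2)"
        unfolding affine_on_def by (intro exI[of _ "- y2"] exI[of _ 1]) simp
      from pos'[OF this] have "0 < (\<Sum>y\<in>Y. (y - y2) * (y - y2) * d y)" using ne Y' by auto
      ultimately show False using ne y0 by (simp add: Y')
    qed
    then have d1: "0 < d y1" using d[of y1] Y' by simp
    have "d y2 \<noteq> 0"
    proof
      assume "d y2 = 0"
      moreover have "affine_on Y (\<lambda>y. y - y1)"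
        unfolding affine_on_def by (intro exI[of _ "- y1"] exI[of _ 1]) simp
      from pos'[OF this] have "0 < (\<Sum>y\<in>Y. (y - y1) * (y - y1) * d y)" using ne Y' by auto
      ultimately show False using ne y0 by (simp add: Y')
    qed
    then have d2: "0 < d y2" using d[of y2] Y' by simp
    define \<tau> where "\<tau> = - e y0 / w y0"
    define e' where "e' y = e y + \<tau> * w y" for y
    have e'0: "e' y0 = 0" using w[OF y0(1)] by (simp add: e'_def \<tau>_def)
    \<comment> \<open>The value \<open>u y\<close> minimises the form on line \<open>y\<close>. An
      affine \<open>c\<close> can meet two such values, and line \<open>y0\<close> contributes
      nothing, because \<open>d\<close> and \<open>e'\<close> vanish there.\<close>
    define u where "u y = - e' y / d y" for y
    define r where "r = (u y2 - u y1) / (y2 - y1)"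
    define c where "c y = u y1 + r * (y - y1)" for y
    have c: "c y1 = u y1" "c y2 = u y2" using ne by (simp_all add: c_def r_def)
    have "affine_on Y c" unfolding affine_on_def
      by (intro exI[of _ "u y1 - r * y1"] exI[of _ r]) (simp add: c_def algebra_simps)
    from shift[OF this, of \<tau>]
    have "0 < sum f Y + (\<Sum>y\<in>Y. 2 * c y * e' y + c y * c y * d y)" by (simp add: e'_def)
    also have "(\<Sum>y\<in>Y. 2 * c y * e' y + c y * c y * d y) = - (e' y1)\<^sup>2 / d y1 - (e' y2)\<^sup>2 / d y2"
    proof -
      have u: "2 * u y * e' y + u y * u y * d y = - (e' y)\<^sup>2 / d y" if "0 < d y" for y
        unfolding u_def using that by (simp add: field_simps power2_eq_square)
      show ?thesis using ne e'0 y0 c u[OF d1] u[OF d2] by (simp add: Y')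
    qed
    finally have slack: "(e' y1)\<^sup>2 / d y1 < sum f Y - (e' y2)\<^sup>2 / d y2" by simp
    \<comment> \<open>Line \<open>y2\<close> gets the least admissible value and \<open>y1\<close>
      all the rest, which \<open>slack\<close> shows to be more than the minimum there.\<close>
    define f' where "f' y = (if y = y0 then 0 else if y = y2 then (e' y2)\<^sup>2 / d y2
      else sum f Y - (e' y2)\<^sup>2 / d y2)" for y
    define s where "s y = (if y = y0 then 0 else if y = y2 then 1 else 2::nat)" for y
    have "sum f' Y = sum f Y" unfolding Y' using ne by (simp add: f'_def Y')
    moreover have "sum s Y = 3" unfolding Y' using ne by (simp add: s_def)
    moreover have "(e' y1)\<^sup>2 < d y1 * f' y1" using slack d1 ne by (simp add: f'_def field_simps)
    moreover have "d y2 * f' y2 = (e' y2)\<^sup>2" using d2 ne by (simp add: f'_def)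
    moreover have "f' y0 = 0" by (simp add: f'_def)
    moreover have "s y0 = 0" "s y1 = 2" "s y2 = 1" using ne by (auto simp: s_def)
    ultimately show ?thesis
      using y0 d1 d2 e'0 Y' unfolding e'_def
      by (intro exI[of _ \<tau>] exI[of _ f'] exI[of _ s]) auto
  qed
qed

text \<open>Interpolation of \<open>X^a\<close>, read coefficientwise: the coefficients of the
  Lagrange basis invert the Vandermonde matrix of the nodes.\<close>

lemma lagrange_moments:
  assumes Y: "finite Y" and "a < card Y"
  shows "(\<Sum>y\<in>Y. y ^ a * coeff (lagrange Y y) j) = (if j = a then 1 else 0)"
proof -
  have "deg_lt (card Y) (monom 1 a)" using assms(2) by (auto simp: deg_lt_def)
  from arg_cong[OF lagrange_interpolation[OF Y this], of "\<lambda>p. coeff p j", symmetric] show ?thesis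
    by (auto simp: coeff_sum poly_monom)
qed

text \<open>The sum is the second divided difference of \<open>c\<close>, that is, the coefficient
  of \<open>X^2\<close> in its interpolation polynomial.\<close>

lemma affine_on_iff_divided_difference:
  assumes Y: "finite Y" "card Y = 3"
  shows "affine_on Y c \<longleftrightarrow> (\<Sum>y\<in>Y. coeff (lagrange Y y) 2 * c y) = 0"
proof
  assume "affine_on Y c"
  then obtain A B where "\<forall>y\<in>Y. c y = A + B * y" unfolding affine_on_def by blast
  then have "(\<Sum>y\<in>Y. coeff (lagrange Y y) 2 * c y) =
      (\<Sum>y\<in>Y. A * (y ^ 0 * coeff (lagrange Y y) 2) + B * (y ^ 1 * coeff (lagrange Y y) 2))"
    by (intro sum.cong) (auto simp: algebra_simps)
  also have "\<dots> = A * (\<Sum>y\<in>Y. y ^ 0 * coeff (lagrange Y y) 2) + B * (\<Sum>y\<in>Y. y ^ 1 * coeff (lagrange Y y) 2)"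
    by (simp only: sum.distrib sum_distrib_left)
  finally show "(\<Sum>y\<in>Y. coeff (lagrange Y y) 2 * c y) = 0"
    using lagrange_moments[OF Y(1), of 0 2] lagrange_moments[OF Y(1), of 1 2] Y by simp
next
  assume 0: "(\<Sum>y\<in>Y. coeff (lagrange Y y) 2 * c y) = 0"
  define p where "p = (\<Sum>y\<in>Y. Polynomial.smult (c y) (lagrange Y y))"
  have "degree p \<le> 2"
    unfolding p_def using Y by (intro degree_sum_le) (auto simp: degree_lagrange intro: order.trans[OF degree_smult_le])
  moreover have "coeff p 2 = 0" using 0 by (simp add: p_def coeff_sum mult.commute)
  ultimately have "coeff p i = 0" if "2 \<le> i" for i
    using that by (cases "i = 2") (auto intro: coeff_eq_0)
  then have "p = [:coeff p 0, coeff p 1:]"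
    by (intro poly_eqI) (auto simp: coeff_pCons split: nat.split simp flip: One_nat_def)
  then have "poly p y = coeff p 0 + coeff p 1 * y" for y
    by (metis add.right_neutral mult.commute mult_zero_right poly_0 poly_pCons)
  moreover have "poly p y = c y" if "y \<in> Y" for y
    using that Y by (simp add: p_def poly_sum poly_lagrange if_distrib cong: if_cong)
  ultimately show "affine_on Y c" unfolding affine_on_def by metis
qed

lemma mom_perturb:
  "mom (\<lambda>i. m i + (if i = a then u else 0)) p = mom m p + u * coeff p a"
proof -
  have "(\<Sum>i\<le>degree p. coeff p i * (if i = a then u else 0)) = u * coeff p a"
    by (simp add: if_distrib[of "\<lambda>x. _ * x"] coeff_eq_0 cong: if_cong)
  then show ?thesis by (simp add: mom_def algebra_simps sum.distrib)
qed

text \<open>Here \<open>n = k - 1\<close>. The families \<open>p\<close> in \<open>pd\<close> are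
  the restrictions to the lines of the polynomials spanned by \<open>C2 k\<close>. The sequence
  \<open>\<beta>\<close> prescribes the moments of degree \<open>2 * n + 1\<close> only against 1
  and \<open>y\<close>, and those of degree \<open>2 * n + 2\<close> only against 1; exactly these
  combinations are preserved.\<close>

lemma three_lines:
  assumes Y: "finite Y" "card Y = 3"
    and psd: "\<And>y q. y \<in> Y \<Longrightarrow> deg_lt (Suc n) q \<Longrightarrow> 0 \<le> mom (m y) (q * q)"
    and pd: "\<And>p a. (\<And>y. y \<in> Y \<Longrightarrow> degree (p y) \<le> Suc n \<and> coeff (p y) (Suc n) = a) \<Longrightarrow>
      affine_on Y (\<lambda>y. coeff (p y) n) \<Longrightarrow> \<exists>y\<in>Y. p y \<noteq> 0 \<Longrightarrow>
      0 < (\<Sum>y\<in>Y. mom (m y) (p y * p y))"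
  shows "\<exists>m' c. (\<forall>y\<in>Y. (\<forall>i\<le>2 * n. m' y i = m y i) \<and> atomic_upto (2 * n + 3) (m' y) (c y)) \<and>
    (\<forall>j\<le>1. (\<Sum>y\<in>Y. m' y (2 * n + 1) * y ^ j) = (\<Sum>y\<in>Y. m y (2 * n + 1) * y ^ j)) \<and>
    (\<Sum>y\<in>Y. m' y (2 * n + 2)) = (\<Sum>y\<in>Y. m y (2 * n + 2)) \<and>
    sum c Y = 3 * (n + 1)"
proof -
  \<comment> \<open>A polynomial of degree below \<open>n\<close> on one line, extended by 0 to the
    others, meets both coefficient conditions of \<open>pd\<close>.\<close>
  have pdl: "posdef_below n (m y)" if y: "y \<in> Y" for y
    unfolding posdef_below_def
  proof (intro allI impI, elim conjE)
    fix q assume q: "deg_lt n q" "q \<noteq> 0"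
    define p where "p v = (if v = y then q else 0)" for v
    have "0 < (\<Sum>y\<in>Y. mom (m y) (p y * p y))"
    proof (rule pd)
      show "affine_on Y (\<lambda>y. coeff (p y) n)"
        using q by (auto simp: affine_on_def p_def deg_lt_def intro!: exI[of _ 0])
      show "\<exists>y\<in>Y. p y \<noteq> 0" using y q by (auto simp: p_def)
      show "degree (p v) \<le> Suc n \<and> coeff (p v) (Suc n) = 0" for v
        using q by (auto simp: p_def deg_lt_iff coeff_eq_0)
    qed
    also have "(\<Sum>y\<in>Y. mom (m y) (p y * p y)) = (\<Sum>v\<in>Y. if v = y then mom (m y) (q * q) else 0)"
      by (rule sum.cong) (auto simp: p_def)
    finally show "0 < mom (m y) (q * q)" using Y y by simp
  qed
  have "\<exists>q. deg_lt n q \<and> orth_below n (m y) (monom 1 n - q)" if "y \<in> Y" for y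
    by (rule exists_orth_projection[OF pdl[OF that]])
  then obtain qg where qg: "\<And>y. y \<in> Y \<Longrightarrow> deg_lt n (qg y) \<and> orth_below n (m y) (monom 1 n - qg y)"
    by metis
  have "\<exists>q. deg_lt n q \<and> orth_below n (m y) (monom 1 (Suc n) - q)" if "y \<in> Y" for y
    by (rule exists_orth_projection[OF pdl[OF that]])
  then obtain qh where qh: "\<And>y. y \<in> Y \<Longrightarrow> deg_lt n (qh y) \<and> orth_below n (m y) (monom 1 (Suc n) - qh y)"
    by metis
  define g where "g y = monom 1 n - qg y" for y
  \<comment> \<open>Subtracting only degrees below \<open>n\<close> leaves \<open>h\<close> without
    a term in \<open>X^n\<close>. In \<open>h + c g\<close> the coefficient of \<open>X^n\<close> is
    then \<open>c\<close> itself, and \<open>h * h\<close> has no term of degree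
    \<open>2 * n + 1\<close>.\<close>
  define h where "h y = monom 1 (Suc n) - qh y" for y
  have g: "degree (g y) = n" "coeff (g y) n = 1" "orth_below n (m y) (g y)" if "y \<in> Y" for y
    using qg[OF that] monic_sub_deg_lt by (auto simp: g_def)
  have h: "degree (h y) = Suc n" "coeff (h y) (Suc n) = 1" "orth_below n (m y) (h y)" "coeff (h y) n = 0"
    if "y \<in> Y" for y
  proof -
    have "deg_lt (Suc n) (qh y)" using qh[OF that] deg_lt_mono by fastforce
    then show "degree (h y) = Suc n" "coeff (h y) (Suc n) = 1" using monic_sub_deg_lt by (auto simp: h_def)
    show "orth_below n (m y) (h y)" "coeff (h y) n = 0" using qh[OF that] by (auto simp: h_def deg_lt_def)
  qed
  define d where "d y = mom (m y) (g y * g y)" for y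
  define e where "e y = mom (m y) (h y * g y)" for y
  define f where "f y = mom (m y) (h y * h y)" for y
  define w where "w y = coeff (lagrange Y y) 2" for y
  have "\<exists>\<tau> f' (s :: real \<Rightarrow> nat). sum f' Y = sum f Y \<and> sum s Y = 3 \<and>
    (\<forall>y\<in>Y. d y = 0 \<and> e y + \<tau> * w y = 0 \<and> f' y = 0 \<and> s y = 0 \<or>
      0 < d y \<and> d y * f' y = (e y + \<tau> * w y)\<^sup>2 \<and> s y = 1 \<or>
      0 < d y \<and> (e y + \<tau> * w y)\<^sup>2 < d y * f' y \<and> s y = 2)"
  proof (rule choose_parameters[OF Y])
    show "0 \<le> d y" if "y \<in> Y" for y
      unfolding d_def using that g by (intro psd) (auto simp: deg_lt_Suc)
    show "w y \<noteq> 0" if "y \<in> Y" for y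
      using lead_coeff_lagrange[OF Y(1) that] Y by (simp add: w_def numeral_2_eq_2)
    show "affine_on Y c \<longleftrightarrow> (\<Sum>y\<in>Y. w y * c y) = 0" for c
      unfolding w_def by (rule affine_on_iff_divided_difference[OF Y])
  next
    fix c assume c: "affine_on Y c"
    define p where "p y = h y + Polynomial.smult (c y) (g y)" for y
    have "0 < (\<Sum>y\<in>Y. mom (m y) (p y * p y))"
    proof (rule pd)
      show "degree (p y) \<le> Suc n \<and> coeff (p y) (Suc n) = 1" if "y \<in> Y" for y
        using g[OF that] h[OF that] unfolding p_def
        by (auto intro!: degree_add_le order.trans[OF degree_smult_le] simp: coeff_eq_0)
      show "affine_on Y (\<lambda>y. coeff (p y) n)"
        using c g h unfolding affine_on_def p_def by auto
      have "Y \<noteq> {}" using Y by auto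
      then obtain y where y: "y \<in> Y" by blast
      then have "coeff (p y) (Suc n) = 1" using g[OF y] h[OF y] by (simp add: p_def coeff_eq_0)
      then show "\<exists>y\<in>Y. p y \<noteq> 0" using y by (intro bexI[of _ y]) auto
    qed
    moreover have "p y * p y = h y * h y + (Polynomial.smult (c y) (h y * g y)
        + Polynomial.smult (c y) (h y * g y)) + Polynomial.smult (c y * c y) (g y * g y)" for y
      by (simp add: p_def algebra_simps)
    ultimately show "0 < (\<Sum>y\<in>Y. f y + 2 * c y * e y + c y * c y * d y)"
      by (simp only: mom_add mom_smult) (simp add: d_def e_def f_def algebra_simps)
  next
    fix c assume c: "affine_on Y c" "\<exists>y\<in>Y. c y \<noteq> 0"
    define p where "p y = Polynomial.smult (c y) (g y)" for y
    have "0 < (\<Sum>y\<in>Y. mom (m y) (p y * p y))"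
    proof (rule pd)
      show "degree (p y) \<le> Suc n \<and> coeff (p y) (Suc n) = 0" if "y \<in> Y" for y
        using g[OF that] unfolding p_def
        by (auto intro!: order.trans[OF degree_smult_le] simp: coeff_eq_0)
      show "affine_on Y (\<lambda>y. coeff (p y) n)"
        using c g unfolding affine_on_def p_def by auto
      show "\<exists>y\<in>Y. p y \<noteq> 0" using c g unfolding p_def by (metis coeff_0 smult_eq_0_iff zero_neq_one)
    qed
    then show "0 < (\<Sum>y\<in>Y. c y * c y * d y)"
      by (simp add: p_def d_def mom_smult mult.assoc)
  qed
  then obtain \<tau> f' and s :: "real \<Rightarrow> nat" where sf: "sum f' Y = sum f Y" "sum s Y = 3"
    and cases: "\<And>y. y \<in> Y \<Longrightarrow> d y = 0 \<and> e y + \<tau> * w y = 0 \<and> f' y = 0 \<and> s y = 0 \<or>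
      0 < d y \<and> d y * f' y = (e y + \<tau> * w y)\<^sup>2 \<and> s y = 1 \<or>
      0 < d y \<and> (e y + \<tau> * w y)\<^sup>2 < d y * f' y \<and> s y = 2"
    by metis
  \<comment> \<open>The product \<open>g * g\<close> has degree \<open>2 * n\<close> and ignores the
    change, \<open>h * g\<close> sees only the first summand, and \<open>h * h\<close> only the
    second.\<close>
  define m' where "m' y i = m y i + (if i = 2 * n + 1 then \<tau> * w y else 0)
    + (if i = 2 * n + 2 then f' y - f y else 0)" for y i
  have mom': "mom (m' y) p = mom (m y) p + \<tau> * w y * coeff p (2 * n + 1)
      + (f' y - f y) * coeff p (2 * n + 2)" for y p
    unfolding m'_def by (simp only: mom_perturb)
  have mom'_low: "mom (m' y) p = mom (m y) p" if "deg_lt (2 * n + 1) p" for y p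
    using that by (simp add: mom' deg_lt_def)
  have atoms: "atomic_upto (2 * n + 3) (m' y) (n + s y)" if y: "y \<in> Y" for y
  proof -
    note gy = g[OF y] and hy = h[OF y]
    have lt_g: "deg_lt (Suc n) (g y)" and lt_h: "deg_lt (Suc (Suc n)) (h y)"
      using gy hy by (auto simp: deg_lt_Suc)
    have d': "mom (m' y) (g y * g y) = d y"
      using deg_lt_mult[OF lt_g lt_g] by (simp add: mom'_low d_def mult_2)
    have "coeff (h y * g y) (2 * n + 1) = 1"
      using coeff_mult_degree_sum[of "h y" "g y"] gy hy by (simp add: mult_2)
    moreover have "coeff (h y * g y) (2 * n + 2) = 0"
      using deg_lt_mult[OF lt_h lt_g] by (simp add: deg_lt_def)
    ultimately have e': "mom (m' y) (h y * g y) = e y + \<tau> * w y"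
      by (simp add: mom' e_def)
    have "coeff (h y * h y) (2 * n + 2) = 1"
      using coeff_mult_degree_sum[of "h y" "h y"] hy by (simp add: mult_2)
    \<comment> \<open>Two indices with sum \<open>2 * n + 1\<close> include either one above
      \<open>n + 1\<close> or the index \<open>n\<close>.\<close>
    moreover have "coeff (h y * h y) (2 * n + 1) = 0"
      unfolding coeff_mult
    proof (rule sum.neutral, rule ballI)
      fix i assume "i \<in> {..2 * n + 1}"
      then consider "2 * n + 1 - i > Suc n" | "i = n" | "2 * n + 1 - i = n" | "i > Suc n"
        by (simp; linarith)
      then show "coeff (h y) i * coeff (h y) (2 * n + 1 - i) = 0"
        using hy by cases (simp_all add: coeff_eq_0)
    qed
    ultimately have f'': "mom (m' y) (h y * h y) = f' y"
      by (simp add: mom' f_def)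
    interpret line n "m' y" "g y" "h y"
    proof
      show "posdef_below n (m' y)"
        unfolding posdef_below_def
      proof (intro allI impI, elim conjE)
        fix q assume q: "deg_lt n q" "q \<noteq> 0"
        have "deg_lt (2 * n + 1) (q * q)"
          using deg_lt_mult[OF q(1) q(1)] by (rule deg_lt_mono) simp
        then show "0 < mom (m' y) (q * q)"
          using posdef_belowD[OF pdl[OF y] q] by (simp add: mom'_low)
      qed
      show "orth_below n (m' y) (g y)" unfolding orth_below_def
      proof (intro allI impI)
        fix r assume r: "deg_lt n r"
        have "deg_lt (2 * n + 1) (g y * r)"
          using deg_lt_mult[OF lt_g r] by (rule deg_lt_mono) simp
        then show "mom (m' y) (g y * r) = 0"
          using orth_belowD[OF gy(3) r] by (simp add: mom'_low)
      qed
      show "orth_below n (m' y) (h y)" unfolding orth_below_def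
      proof (intro allI impI)
        fix r assume r: "deg_lt n r"
        have "deg_lt (2 * n + 1) (h y * r)"
          using deg_lt_mult[OF lt_h r] by (rule deg_lt_mono) simp
        then show "mom (m' y) (h y * r) = 0"
          using orth_belowD[OF hy(3) r] by (simp add: mom'_low)
      qed
    qed (use gy hy in auto)
    from cases[OF y] show ?thesis
    proof (elim disjE conjE)
      assume "d y = 0" "e y + \<tau> * w y = 0" "f' y = 0" "s y = 0"
      then show ?thesis using atomic_singular[unfolded d' e' f''] by simp
    next
      assume "0 < d y" "d y * f' y = (e y + \<tau> * w y)\<^sup>2" "s y = 1"
      then show ?thesis using atomic_tight[unfolded d' e' f''] by simp
    next
      assume "0 < d y" "(e y + \<tau> * w y)\<^sup>2 < d y * f' y" "s y = 2"
      then show ?thesis using atomic_slack[unfolded d' e' f''] by simp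
    qed
  qed
  have "(\<Sum>y\<in>Y. m' y (2 * n + 1) * y ^ j) = (\<Sum>y\<in>Y. m y (2 * n + 1) * y ^ j)" if "j \<le> 1" for j
  proof -
    have "(\<Sum>y\<in>Y. w y * y ^ j) = 0"
      using lagrange_moments[OF Y(1), of j 2] Y that by (simp add: w_def mult.commute)
    moreover have "(\<Sum>y\<in>Y. m' y (2 * n + 1) * y ^ j) =
        (\<Sum>y\<in>Y. m y (2 * n + 1) * y ^ j) + \<tau> * (\<Sum>y\<in>Y. w y * y ^ j)"
      by (simp add: m'_def sum_distrib_left algebra_simps sum.distrib)
    ultimately show ?thesis by simp
  qed
  moreover have "(\<Sum>y\<in>Y. m' y (2 * n + 2)) = (\<Sum>y\<in>Y. m y (2 * n + 2))"
    using sf(1) by (simp add: m'_def sum.distrib sum_subtractf)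
  moreover have "\<forall>y\<in>Y. \<forall>i\<le>2 * n. m' y i = m y i" by (simp add: m'_def)
  moreover have "(\<Sum>y\<in>Y. n + s y) = 3 * (n + 1)" using sf(2) Y by (simp add: sum.distrib)
  ultimately show ?thesis using atoms by (intro exI[of _ m'] exI[of _ "\<lambda>y. n + s y"]) auto
qed

section \<open>Moment matrices as quadratic forms\<close>

text \<open>The coefficients are indexed by monomials instead of vector positions, so the order of
  the list disappears.\<close>

definition quad_form ::
    "(nat \<times> nat) set \<Rightarrow> (nat \<Rightarrow> nat \<Rightarrow> real) \<Rightarrow> (nat \<times> nat \<Rightarrow> real) \<Rightarrow> real" where
  "quad_form S \<gamma> c = (\<Sum>s\<in>S. \<Sum>t\<in>S. c s * c t * \<gamma> (fst s + fst t) (snd s + snd t))"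

lemma sum_nth_distinct:
  "distinct xs \<Longrightarrow> (\<Sum>a<length xs. F (xs ! a)) = (\<Sum>x\<in>set xs. F x)"
  using sum.reindex_bij_betw[OF bij_betw_nth[OF _ refl refl], of xs F] by simp

lemma moment_matrix_on_square: "square_mat (moment_matrix_on ms \<gamma>)"
  and moment_matrix_on_transpose: "(moment_matrix_on ms \<gamma>)\<^sup>T = moment_matrix_on ms \<gamma>"
  and dim_row_moment_matrix_on [simp]: "dim_row (moment_matrix_on ms \<gamma>) = length ms"
  by (auto simp: moment_matrix_on_def add.commute)

lemma moment_matrix_on_mult_vec:
  assumes "distinct ms" "r < length ms"
  shows "(moment_matrix_on ms \<gamma> *\<^sub>v Matrix.vec (length ms) (\<lambda>a. c (ms ! a))) $ r =
    (\<Sum>t\<in>set ms. c t * \<gamma> (fst (ms ! r) + fst t) (snd (ms ! r) + snd t))"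
proof -
  have "(moment_matrix_on ms \<gamma> *\<^sub>v Matrix.vec (length ms) (\<lambda>a. c (ms ! a))) $ r =
      (\<Sum>a<length ms. c (ms ! a) * \<gamma> (fst (ms ! r) + fst (ms ! a)) (snd (ms ! r) + snd (ms ! a)))"
    using assms(2) by (simp add: moment_matrix_on_def scalar_prod_def lessThan_atLeast0 mult.commute)
  also have "\<dots> = (\<Sum>t\<in>set ms. c t * \<gamma> (fst (ms ! r) + fst t) (snd (ms ! r) + snd t))"
    by (rule sum_nth_distinct[OF assms(1)])
  finally show ?thesis .
qed

lemma quad_form_moment_matrix_on:
  assumes "distinct ms"
  defines "v \<equiv> \<lambda>c. Matrix.vec (length ms) (\<lambda>a. c (ms ! a))"
  shows "v c \<bullet> (moment_matrix_on ms \<gamma> *\<^sub>v v c) = quad_form (set ms) \<gamma> c"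
proof -
  have "v c \<bullet> (moment_matrix_on ms \<gamma> *\<^sub>v v c) =
      (\<Sum>r<length ms. c (ms ! r) * (\<Sum>t\<in>set ms. c t * \<gamma> (fst (ms ! r) + fst t) (snd (ms ! r) + snd t)))"
    unfolding scalar_prod_def v_def
    by (intro sum.cong)
       (auto simp: moment_matrix_on_mult_vec[OF assms(1)] lessThan_atLeast0 simp del: index_mult_mat_vec(1))
  also have "\<dots> = (\<Sum>s\<in>set ms. c s * (\<Sum>t\<in>set ms. c t * \<gamma> (fst s + fst t) (snd s + snd t)))"
    by (rule sum_nth_distinct[OF assms(1)])
  finally show ?thesis by (simp add: quad_form_def sum_distrib_left mult.assoc)
qed

lemma vec_from_nth:
  assumes "distinct ms" "v \<in> carrier_vec (length ms)"
  obtains c where "v = Matrix.vec (length ms) (\<lambda>a. c (ms ! a))"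
proof
  show "v = Matrix.vec (length ms) (\<lambda>a. (\<lambda>s. v $ the_inv_into {..<length ms} ((!) ms) s) (ms ! a))"
    using assms the_inv_into_f_f[OF inj_on_nth[OF assms(1)], of "{..<length ms}"] by auto
qed

lemma pos_def_quad_form:
  assumes pd: "pos_def (moment_matrix_on ms \<gamma>)" and "distinct ms" "s \<in> set ms" "c s \<noteq> 0"
  shows "0 < quad_form (set ms) \<gamma> c"
proof -
  define v where "v = Matrix.vec (length ms) (\<lambda>a. c (ms ! a))"
  obtain a where a: "a < length ms" "ms ! a = s" using assms(3) by (auto simp: in_set_conv_nth)
  then have "v $ a \<noteq> 0" using assms(4) by (simp add: v_def)
  then have "v \<noteq> 0\<^sub>v (length ms)" using a(1) index_zero_vec(1) by metis
  moreover have "v \<in> carrier_vec (length ms)" by (simp add: v_def)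
  ultimately have "0 < v \<bullet> (moment_matrix_on ms \<gamma> *\<^sub>v v)"
    using pd unfolding pos_def_def dim_row_moment_matrix_on by blast
  then show ?thesis unfolding v_def quad_form_moment_matrix_on[OF assms(2)] .
qed

lemma pos_semidef_iff_quad_form:
  assumes "distinct ms"
  shows "pos_semidef (moment_matrix_on ms \<gamma>) \<longleftrightarrow> (\<forall>c. 0 \<le> quad_form (set ms) \<gamma> c)"
proof
  assume psd: "pos_semidef (moment_matrix_on ms \<gamma>)"
  show "\<forall>c. 0 \<le> quad_form (set ms) \<gamma> c"
  proof
    fix c :: "nat \<times> nat \<Rightarrow> real"
    have "Matrix.vec (length ms) (\<lambda>a. c (ms ! a)) \<in> carrier_vec (length ms)" by simp
    then have "0 \<le> Matrix.vec (length ms) (\<lambda>a. c (ms ! a)) \<bullet>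
        (moment_matrix_on ms \<gamma> *\<^sub>v Matrix.vec (length ms) (\<lambda>a. c (ms ! a)))"
      using psd by (simp only: pos_semidef_def dim_row_moment_matrix_on)
    then show "0 \<le> quad_form (set ms) \<gamma> c" by (simp only: quad_form_moment_matrix_on[OF assms])
  qed
next
  assume "\<forall>c. 0 \<le> quad_form (set ms) \<gamma> c"
  then have "0 \<le> v \<bullet> (moment_matrix_on ms \<gamma> *\<^sub>v v)" if "v \<in> carrier_vec (length ms)" for v
    using vec_from_nth[OF assms that] quad_form_moment_matrix_on[OF assms, where \<gamma> = \<gamma>] by metis
  then show "pos_semidef (moment_matrix_on ms \<gamma>)"
    by (simp add: pos_semidef_def moment_matrix_on_transpose moment_matrix_on_square del: square_mat.simps)
qed

text \<open>If \<open>\<gamma>\<close> comes from functionals on horizontal lines, its form at the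
  coefficients of a polynomial sums the functionals at the squares of the restrictions. The ordinate
  \<open>b y\<close> is \<open>y\<close> for \<open>\<beta>\<close> and \<open>y - \<alpha>1\<close>
  for the shifted moments.\<close>

lemma quad_form_eq_sum_mom:
  fixes c :: "nat \<times> nat \<Rightarrow> real"
  assumes \<gamma>: "\<And>s t. s \<in> S \<Longrightarrow> t \<in> S \<Longrightarrow> \<gamma> (fst s + fst t) (snd s + snd t) =
      (\<Sum>y\<in>Y. m y (fst s + fst t) * b y ^ (snd s + snd t))"
  defines "P \<equiv> \<lambda>y. \<Sum>s\<in>S. monom (c s * b y ^ snd s) (fst s)"
  shows "quad_form S \<gamma> c = (\<Sum>y\<in>Y. mom (m y) (P y * P y))"
proof -
  have "mom (m y) (P y * P y) =
      (\<Sum>s\<in>S. \<Sum>t\<in>S. c s * c t * (m y (fst s + fst t) * b y ^ (snd s + snd t)))" for y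
    unfolding P_def sum_product mult_monom mom_sum mom_monom
    by (intro sum.cong refl) (simp add: power_add algebra_simps)
  then have "(\<Sum>y\<in>Y. mom (m y) (P y * P y)) =
      (\<Sum>s\<in>S. \<Sum>t\<in>S. \<Sum>y\<in>Y. c s * c t * (m y (fst s + fst t) * b y ^ (snd s + snd t)))"
    by (simp add: sum.swap[of _ _ Y])
  also have "\<dots> = quad_form S \<gamma> c"
    unfolding quad_form_def by (intro sum.cong refl) (simp add: \<gamma> sum_distrib_left)
  finally show ?thesis by simp
qed

lemma sum_monom_rectangle:
  fixes c :: "nat \<times> nat \<Rightarrow> real"
  shows "coeff (\<Sum>s\<in>{..<K} \<times> {..<J}. monom (c s * u ^ snd s) (fst s)) i =
    (if i < K then \<Sum>j<J. c (i, j) * u ^ j else 0)"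
proof -
  have "coeff (\<Sum>s\<in>{..<K} \<times> {..<J}. monom (c s * u ^ snd s) (fst s)) i =
      (\<Sum>a<K. \<Sum>j<J. if a = i then c (a, j) * u ^ j else 0)"
    unfolding coeff_sum sum.cartesian_product by (rule sum.cong) auto
  also have "\<dots> = (\<Sum>a<K. if a = i then \<Sum>j<J. c (i, j) * u ^ j else 0)"
    by (rule sum.cong) auto
  finally show ?thesis by simp
qed

lemma poly_eq_sum_lessThan:
  fixes p :: "real poly"
  assumes "deg_lt n p"
  shows "poly p x = (\<Sum>i<n. coeff p i * x ^ i)"
proof -
  have "poly p x = (\<Sum>i\<le>degree p. coeff p i * x ^ i)" by (rule poly_altdef)
  also have "\<dots> = (\<Sum>i\<in>{..<n} \<inter> {..degree p}. coeff p i * x ^ i)"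
    by (rule sum.mono_neutral_right) (use assms in \<open>auto simp: deg_lt_def\<close>)
  also have "\<dots> = (\<Sum>i<n. coeff p i * x ^ i)"
    by (rule sum.mono_neutral_left) (auto simp: coeff_eq_0)
  finally show ?thesis .
qed

section \<open>Reduction to three univariate sequences\<close>

text \<open>The functional of \<open>\<beta>\<close> at \<open>x^i\<close> times the Lagrange
  polynomial in \<open>y\<close>, which on \<open>K\<close> is the indicator of one line. For
  \<open>i > 2 * k - 2\<close> this reads values of \<open>\<beta>\<close> beyond degree
  \<open>2 * k\<close>: these are the free parameters that \<open>three_lines\<close>
  adjusts.\<close>

definition line_moments :: "real set \<Rightarrow> (nat \<Rightarrow> nat \<Rightarrow> real) \<Rightarrow> real \<Rightarrow> nat \<Rightarrow> real" where
  "line_moments Y \<beta> y i = (\<Sum>j<card Y. coeff (lagrange Y y) j * \<beta> i j)"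

lemma sum_line_moments:
  assumes "finite Y" "j < card Y"
  shows "(\<Sum>y\<in>Y. line_moments Y \<beta> y i * y ^ j) = \<beta> i j"
proof -
  have "(\<Sum>y\<in>Y. line_moments Y \<beta> y i * y ^ j) =
      (\<Sum>a<card Y. \<beta> i a * (\<Sum>y\<in>Y. y ^ j * coeff (lagrange Y y) a))"
    unfolding line_moments_def sum_distrib_left sum_distrib_right
    by (subst sum.swap) (simp add: mult_ac)
  also have "\<dots> = (\<Sum>a<card Y. if a = j then \<beta> i j else 0)"
    by (rule sum.cong) (auto simp: lagrange_moments[OF assms])
  finally show ?thesis using assms by simp
qed

lemma set_C2: "set (C2 k) = {(i, j). j \<le> 2 \<and> i + j \<le> k}"
proof -
  have "(i, j) \<in> set (C2 k) \<longleftrightarrow> j \<le> 2 \<and> i + j \<le> k" for i j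
  proof -
    consider "j = 0" | "j = 1" | "j = 2" | "j > 2" by linarith
    then show ?thesis by cases (auto simp: C2_def)
  qed
  then show ?thesis by auto
qed

lemma distinct_C2: "distinct (C2 k)"
  by (auto simp: C2_def distinct_map inj_on_def)

lemma deg_lt_lagrange: "finite Y \<Longrightarrow> y \<in> Y \<Longrightarrow> deg_lt (card Y) (lagrange Y y)"
  using degree_lagrange[of Y y] card_gt_0_iff[of Y] by (auto simp: deg_lt_iff)

text \<open>Lagrange interpolation in \<open>y\<close> glues the family \<open>p\<close> to one
  bivariate polynomial with coefficients \<open>c\<close>. The two conditions on \<open>p\<close>
  say that it involves only monomials of \<open>C2\<close>.\<close>

lemma pos_def_C2_imp:
  assumes Y: "finite Y" "card Y = 3"
    and pd: "pos_def (moment_matrix_on (C2 (Suc n)) \<beta>)"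
    and \<beta>: "\<And>i j. i + j \<le> 2 * Suc n \<Longrightarrow> \<beta> i j = (\<Sum>y\<in>Y. m y i * y ^ j)"
    and p: "\<And>y. y \<in> Y \<Longrightarrow> degree (p y) \<le> Suc n \<and> coeff (p y) (Suc n) = a"
    and affine: "affine_on Y (\<lambda>y. coeff (p y) n)" and nonzero: "\<exists>y\<in>Y. p y \<noteq> 0"
  shows "0 < (\<Sum>y\<in>Y. mom (m y) (p y * p y))"
proof -
  define c where "c s = (\<Sum>y\<in>Y. coeff (lagrange Y y) (snd s) * coeff (p y) (fst s))" for s :: "nat \<times> nat"
  define P where "P y = (\<Sum>s\<in>set (C2 (Suc n)). monom (c s * y ^ snd s) (fst s))" for y
  \<comment> \<open>Interpolating the constant \<open>a\<close> yields no positive power of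
    \<open>y\<close>, and the second divided difference of an affine function is 0.\<close>
  have c0: "c (i, j) = 0" if "i \<le> Suc n" "j \<le> 2" "Suc n < i + j" for i j
  proof -
    from that consider "i = Suc n" "1 \<le> j" | "i = n" "j = 2" by linarith
    then show ?thesis
    proof cases
      case 1
      then have "c (i, j) = a * (\<Sum>y\<in>Y. y ^ 0 * coeff (lagrange Y y) j)"
        using p by (simp add: c_def sum_distrib_left mult.commute)
      then show ?thesis using lagrange_moments[OF Y(1), of 0 j] Y 1 by simp
    next
      case 2
      then show ?thesis using affine affine_on_iff_divided_difference[OF Y] by (simp add: c_def)
    qed
  qed
  have P: "P y = p y" if y: "y \<in> Y" for y
  proof (rule poly_eqI)
    fix i
    have "P y = (\<Sum>s\<in>{..<Suc (Suc n)} \<times> {..<3}. monom (c s * y ^ snd s) (fst s))"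
      unfolding P_def by (rule sum.mono_neutral_left) (auto simp: set_C2 c0)
    then have "coeff (P y) i = (if i < Suc (Suc n) then \<Sum>j<3. c (i, j) * y ^ j else 0)"
      by (simp only: sum_monom_rectangle)
    also have "(\<Sum>j<3. c (i, j) * y ^ j) =
        (\<Sum>v\<in>Y. coeff (p v) i * (\<Sum>j<3. coeff (lagrange Y v) j * y ^ j))"
      unfolding c_def sum_distrib_left sum_distrib_right by (subst sum.swap) (simp add: mult_ac)
    also have "\<dots> = (\<Sum>v\<in>Y. coeff (p v) i * poly (lagrange Y v) y)"
      using deg_lt_lagrange[OF Y(1)] by (simp add: poly_eq_sum_lessThan[of 3] Y(2))
    also have "\<dots> = (\<Sum>v\<in>Y. if v = y then coeff (p y) i else 0)"
      by (rule sum.cong) (auto simp: poly_lagrange[OF Y(1) y])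
    also have "\<dots> = coeff (p y) i" using Y y by simp
    finally show "coeff (P y) i = coeff (p y) i"
      using p[OF y] by (auto simp: coeff_eq_0)
  qed
  obtain s where s: "s \<in> set (C2 (Suc n))" "c s \<noteq> 0"
  proof (rule ccontr)
    assume "\<not> thesis"
    then have "\<And>s. s \<in> set (C2 (Suc n)) \<Longrightarrow> c s = 0" using that by blast
    then have "P y = 0" for y by (simp add: P_def)
    then show False using P nonzero by metis
  qed
  have "0 < quad_form (set (C2 (Suc n))) \<beta> c"
    by (rule pos_def_quad_form[where c = c, OF pd distinct_C2 s])
  also have "\<dots> = (\<Sum>y\<in>Y. mom (m y) (P y * P y))"
    unfolding P_def by (rule quad_form_eq_sum_mom) (auto simp: set_C2 intro!: \<beta>)
  finally show ?thesis by (simp add: P)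
qed

section \<open>Total degree, and the Riesz functional as a sum over lines\<close>

lemma total_degree_le_mult:
  assumes "total_degree_le d p" "total_degree_le e q"
  shows "total_degree_le (d + e) (p * q)"
  unfolding total_degree_le_def
proof (intro allI impI)
  fix i j assume "coeff (coeff (p * q) j) i \<noteq> 0"
  then have "(\<Sum>t\<le>j. \<Sum>s\<le>i. coeff (coeff p t) s * coeff (coeff q (j - t)) (i - s)) \<noteq> 0"
    by (simp add: coeff_mult coeff_sum)
  then obtain t where t: "t \<le> j" "(\<Sum>s\<le>i. coeff (coeff p t) s * coeff (coeff q (j - t)) (i - s)) \<noteq> 0"
    by (meson atMost_iff sum.neutral)
  then obtain s where s: "s \<le> i" "coeff (coeff p t) s * coeff (coeff q (j - t)) (i - s) \<noteq> 0"
    by (meson atMost_iff sum.neutral)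
  then have "s + t \<le> d" "(i - s) + (j - t) \<le> e"
    using assms unfolding total_degree_le_def by (metis mult_eq_0_iff)+
  then show "i + j \<le> d + e" using s t by simp
qed

lemma total_degree_le_power:
  assumes "total_degree_le d p"
  shows "total_degree_le (n * d) (p ^ n)"
proof (induction n)
  case 0
  show ?case by (auto simp: total_degree_le_def split: if_splits)
next
  case (Suc n)
  then show ?case using total_degree_le_mult[OF assms] by simp
qed

lemma total_degree_le_polyX: "total_degree_le 1 polyX"
  by (auto simp: total_degree_le_def polyX_def coeff_pCons split: nat.splits)

lemma polyY_minus_polyC: "polyY - polyC a = [:[:- a:], 1:]"
  by (simp add: polyY_def polyC_def)

lemma total_degree_le_linear: "total_degree_le 1 (polyY - polyC a)"
  by (auto simp: total_degree_le_def polyY_minus_polyC coeff_pCons split: nat.splits)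

lemma total_degree_le_monom: "total_degree_le (a + b) (monom (monom 1 a) b)"
  by (auto simp: total_degree_le_def split: if_splits)

lemma riesz_eq_sum_mom:
  assumes p: "total_degree_le d p"
    and \<beta>: "\<And>i j. i + j \<le> d \<Longrightarrow> \<beta> i j = (\<Sum>y\<in>Y. m y i * y ^ j)"
  shows "riesz \<beta> p = (\<Sum>y\<in>Y. mom (m y) (poly p [:y:]))"
proof -
  have "mom (m y) (poly p [:y:]) =
      (\<Sum>j\<le>degree p. \<Sum>i\<le>degree (coeff p j). coeff (coeff p j) i * (m y i * y ^ j))" for y
  proof -
    have "poly p [:y:] = (\<Sum>j\<le>degree p. Polynomial.smult (y ^ j) (coeff p j))"
      unfolding poly_altdef by (simp add: poly_const_pow)
    then have "mom (m y) (poly p [:y:]) = (\<Sum>j\<le>degree p. y ^ j * mom (m y) (coeff p j))"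
      by (simp only: mom_sum mom_smult)
    then show ?thesis
      by (simp add: mom_def sum_distrib_left mult_ac)
  qed
  then have "(\<Sum>y\<in>Y. mom (m y) (poly p [:y:])) =
      (\<Sum>j\<le>degree p. \<Sum>i\<le>degree (coeff p j). \<Sum>y\<in>Y. coeff (coeff p j) i * (m y i * y ^ j))"
    by (simp add: sum.swap[of _ _ Y])
  also have "\<dots> = riesz \<beta> p"
    unfolding riesz_def
  proof (intro sum.cong refl)
    fix i j
    show "(\<Sum>y\<in>Y. coeff (coeff p j) i * (m y i * y ^ j)) = coeff (coeff p j) i * \<beta> i j"
      using p \<beta>[of i j] by (cases "coeff (coeff p j) i = 0") (auto simp: total_degree_le_def sum_distrib_left)
  qed
  finally show ?thesis by simp
qed

section \<open>The shifted moments and the matrix \<open>N\<close>\<close>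

lemma shifted_moment_eq:
  assumes \<beta>: "\<And>i j. i + j \<le> d \<Longrightarrow> \<beta> i j = (\<Sum>y\<in>Y. m y i * y ^ j)" and "i + j \<le> d"
  shows "shifted_moment \<beta> a i j = (\<Sum>y\<in>Y. m y i * (y - a) ^ j)"
proof -
  have "total_degree_le (i + j) (polyX ^ i * (polyY - polyC a) ^ j)"
    using total_degree_le_mult[OF total_degree_le_power[OF total_degree_le_polyX]
        total_degree_le_power[OF total_degree_le_linear]] by simp
  moreover have "poly (polyX ^ i * (polyY - polyC a) ^ j) [:y:] = monom ((y - a) ^ j) i" for y
  proof -
    have "poly (polyX ^ i * (polyY - polyC a) ^ j) [:y:] = [:0, 1:] ^ i * [:y - a:] ^ j"
      by (simp add: polyX_def polyY_minus_polyC)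
    also have "\<dots> = monom ((y - a) ^ j) i"
      by (simp add: poly_const_pow monom_altdef)
    finally show ?thesis .
  qed
  ultimately show ?thesis
    unfolding shifted_moment_def using assms
    by (subst riesz_eq_sum_mom[where Y = Y and m = m]) (auto simp: mom_monom mult.commute)
qed

text \<open>On the three lines \<open>t = y - \<alpha>1\<close> satisfies
  \<open>t^3 = (a2 + a3) t^2 - a2 a3 t\<close>. The auxiliary values are defined by this recursion,
  so they are moments of the same line functionals.\<close>

lemma extended_moment_eq:
  assumes \<beta>: "\<And>i j. i + j \<le> 2 * k \<Longrightarrow> \<beta> i j = (\<Sum>y\<in>{\<alpha>1, \<alpha>2, \<alpha>3}. m y i * y ^ j)"
    and "2 \<le> k" "i \<le> 2 * k - 2" "j \<le> 4"
  shows "extended_moment k \<beta> \<alpha>1 \<alpha>2 \<alpha>3 i j = (\<Sum>y\<in>{\<alpha>1, \<alpha>2, \<alpha>3}. m y i * (y - \<alpha>1) ^ j)"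
proof -
  define a2 a3 where "a2 = \<alpha>2 - \<alpha>1" and "a3 = \<alpha>3 - \<alpha>1"
  define s where "s = (\<lambda>i j. \<Sum>y\<in>{\<alpha>1, \<alpha>2, \<alpha>3}. m y i * (y - \<alpha>1) ^ j)"
  have shifted: "shifted_moment \<beta> \<alpha>1 i j = s i j" if "i + j \<le> 2 * k" for i j
    unfolding s_def by (rule shifted_moment_eq[OF \<beta> that])
  have rec: "(a2 + a3) * s i (j + 2) - a2 * a3 * s i (j + 1) = s i (j + 3)" for i j
  proof -
    have "(y - \<alpha>1) ^ (j + 3) = (a2 + a3) * (y - \<alpha>1) ^ (j + 2) - a2 * a3 * (y - \<alpha>1) ^ (j + 1)"
      if "y \<in> {\<alpha>1, \<alpha>2, \<alpha>3}" for y
    proof -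
      have "(y - \<alpha>1) * ((y - \<alpha>1) - a2) * ((y - \<alpha>1) - a3) = 0"
        using that by (auto simp: a2_def a3_def)
      then have "(y - \<alpha>1) ^ j * ((y - \<alpha>1) * ((y - \<alpha>1) - a2) * ((y - \<alpha>1) - a3)) = 0" by simp
      then show ?thesis by (simp add: power_add power2_eq_square power3_eq_cube algebra_simps)
    qed
    then have "s i (j + 3) = (\<Sum>y\<in>{\<alpha>1, \<alpha>2, \<alpha>3}. m y i *
        ((a2 + a3) * (y - \<alpha>1) ^ (j + 2) - a2 * a3 * (y - \<alpha>1) ^ (j + 1)))"
      unfolding s_def by (intro sum.cong refl) (simp only: insert_iff)
    then show ?thesis
      unfolding s_def sum_distrib_left by (simp only: sum_subtractf[symmetric] right_diff_distrib mult.left_commute)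
  qed
  have r: "(a2 + a3) * s i 2 - a2 * a3 * s i 1 = s i 3" "(a2 + a3) * s i 3 - a2 * a3 * s i 2 = s i 4" for i
    using rec[of i 0] rec[of i 1] by (simp_all add: eval_nat_numeral)
  have e: "extended_moment k \<beta> \<alpha>1 \<alpha>2 \<alpha>3 i j =
     (if (i, j) = (2 * k - 3, 4) then s (2 * k - 3) 4
      else if (i, j) = (2 * k - 2, 3) then s (2 * k - 2) 3
      else if (i, j) = (2 * k - 2, 4) then s (2 * k - 2) 4
      else shifted_moment \<beta> \<alpha>1 i j)"
    using \<open>2 \<le> k\<close> by (simp add: extended_moment_def Let_def shifted r r[unfolded One_nat_def] flip: a2_def a3_def)
  show ?thesis
  proof (cases "i + j \<le> 2 * k")
    case True
    then show ?thesis using \<open>2 \<le> k\<close> by (simp add: e shifted s_def)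
  next
    case False
    \<comment> \<open>Within the index range of \<open>N\<close>, degree \<open>2 * k\<close> is
      exceeded at these three places only.\<close>
    then have "(i, j) = (2 * k - 3, 4) \<or> (i, j) = (2 * k - 2, 3) \<or> (i, j) = (2 * k - 2, 4)"
      using assms by auto
    then show ?thesis by (auto simp: e s_def)
  qed
qed

text \<open>Polynomials of degree below \<open>k\<close> in \<open>x\<close> and below 3 in
  \<open>y\<close> restrict to arbitrary triples of polynomials of degree below \<open>k\<close> on
  the lines, so the form of \<open>N\<close> decouples into three Hankel forms.\<close>

lemma pos_semidef_N_iff:
  assumes \<beta>: "\<And>i j. i + j \<le> 2 * k \<Longrightarrow> \<beta> i j = (\<Sum>y\<in>{\<alpha>1, \<alpha>2, \<alpha>3}. m y i * y ^ j)"
    and k: "2 \<le> k" and Y: "card {\<alpha>1, \<alpha>2, \<alpha>3} = 3"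
  shows "pos_semidef (N_matrix k \<beta> \<alpha>1 \<alpha>2 \<alpha>3) \<longleftrightarrow>
    (\<forall>y\<in>{\<alpha>1, \<alpha>2, \<alpha>3}. \<forall>q. deg_lt k q \<longrightarrow> 0 \<le> mom (m y) (q * q))"
proof -
  define Y where "Y = {\<alpha>1, \<alpha>2, \<alpha>3}"
  have Y3: "finite Y" "card Y = 3" using Y by (auto simp: Y_def)
  define ms where "ms = map (\<lambda>i. (i, 0::nat)) [0..<k] @ map (\<lambda>i. (i, 1)) [0..<k] @ map (\<lambda>i. (i, 2)) [0..<k]"
  have "distinct ms" by (auto simp: ms_def distinct_map inj_on_def)
  have set_ms: "set ms = {..<k} \<times> {..<3}"
    by (auto simp: ms_def numeral_3_eq_3 less_Suc_eq numeral_2_eq_2)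
  define P where "P c y = (\<Sum>s\<in>{..<k} \<times> {..<3}. monom (c s * (y - \<alpha>1) ^ snd s) (fst s))"
    for c :: "nat \<times> nat \<Rightarrow> real" and y
  have quad: "quad_form (set ms) (extended_moment k \<beta> \<alpha>1 \<alpha>2 \<alpha>3) c =
      (\<Sum>y\<in>Y. mom (m y) (P c y * P c y))" for c
    unfolding P_def set_ms Y_def
    by (rule quad_form_eq_sum_mom[where b = "\<lambda>y. y - \<alpha>1"]) (auto intro!: extended_moment_eq[OF \<beta> k])
  have psd: "pos_semidef (N_matrix k \<beta> \<alpha>1 \<alpha>2 \<alpha>3) \<longleftrightarrow> (\<forall>c. 0 \<le> (\<Sum>y\<in>Y. mom (m y) (P c y * P c y)))"
    unfolding N_matrix_def ms_def[symmetric] pos_semidef_iff_quad_form[OF \<open>distinct ms\<close>] quad ..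
  show ?thesis
    unfolding psd Y_def[symmetric]
  proof (intro iffI ballI allI impI)
    fix y0 q assume all: "\<forall>c. 0 \<le> (\<Sum>y\<in>Y. mom (m y) (P c y * P c y))" and y0: "y0 \<in> Y" and q: "deg_lt k q"
    \<comment> \<open>The Lagrange polynomial rewritten in the variable
      \<open>y - \<alpha>1\<close>, in which \<open>N\<close> is expressed.\<close>
    define l where "l = pcompose (lagrange Y y0) [:\<alpha>1, 1:]"
    define c where "c s = coeff q (fst s) * coeff l (snd s)" for s :: "nat \<times> nat"
    have "degree l \<le> 2"
      using degree_pcompose_le[of "lagrange Y y0" "[:\<alpha>1, 1:]"] degree_lagrange[OF Y3(1) y0] Y3
      by (simp add: l_def)
    then have l: "deg_lt 3 l" by (auto simp: deg_lt_iff)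
    have "P c y = (if y = y0 then q else 0)" if "y \<in> Y" for y
    proof (rule poly_eqI)
      fix i
      have "(\<Sum>j<3. c (i, j) * (y - \<alpha>1) ^ j) = coeff q i * poly l (y - \<alpha>1)"
        by (simp add: poly_eq_sum_lessThan[OF l] c_def sum_distrib_left mult.assoc)
      also have "poly l (y - \<alpha>1) = (if y = y0 then 1 else 0)"
        by (simp add: l_def poly_pcompose poly_lagrange[OF Y3(1) that])
      finally show "coeff (P c y) i = coeff (if y = y0 then q else 0) i"
        using q unfolding P_def sum_monom_rectangle by (auto simp: deg_lt_def)
    qed
    then have "(\<Sum>y\<in>Y. mom (m y) (P c y * P c y)) = (\<Sum>y\<in>Y. if y = y0 then mom (m y0) (q * q) else 0)"
      by (intro sum.cong) auto
    also have "\<dots> = mom (m y0) (q * q)" using Y3 y0 by simp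
    finally show "0 \<le> mom (m y0) (q * q)" using all by metis
  next
    fix c assume "\<forall>y\<in>Y. \<forall>q. deg_lt k q \<longrightarrow> 0 \<le> mom (m y) (q * q)"
    moreover have "deg_lt k (P c y)" for y
      unfolding deg_lt_def P_def sum_monom_rectangle by simp
    ultimately show "0 \<le> (\<Sum>y\<in>Y. mom (m y) (P c y * P c y))" by (intro sum_nonneg) blast
  qed
qed

section \<open>The column relation\<close>

lemma set_monomials_upto: "set (monomials_upto k) = {(i, j). i + j \<le> k}"
proof -
  have "set (monomials_upto k) = (\<Union>d\<in>{..k}. (\<lambda>j. (d - j, j)) ` {..d})"
    by (auto simp: monomials_upto_def atLeast0LessThan lessThan_Suc_atMost simp del: upt_Suc)
  moreover have "(i, j) \<in> (\<Union>d\<in>{..k}. (\<lambda>j. (d - j, j)) ` {..d})" if "i + j \<le> k" for i j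
    using that by (intro UN_I[of "i + j"] image_eqI[of _ _ j]) auto
  ultimately show ?thesis by auto
qed

lemma distinct_monomials_upto: "distinct (monomials_upto k)"
proof -
  \<comment> \<open>Distinctness by counting: the length equals the number of listed
    monomials.\<close>
  have "length (monomials_upto k) = (\<Sum>d\<le>k. d + 1)"
    by (simp add: monomials_upto_def length_concat comp_def sum_list_sum_nth atLeast0LessThan
        flip: lessThan_Suc_atMost del: upt_Suc sum.lessThan_Suc)
  also have "\<dots> = card (Sigma {..k} (\<lambda>d. {..d}))" by simp
  also have "\<dots> = card {(i, j). i + j \<le> k}"
    by (rule bij_betw_same_card[of "\<lambda>(d, j). (d - j, j)"],
        rule bij_betw_byWitness[of _ "\<lambda>(i, j). (i + j, j)"]) auto
  finally show ?thesis by (simp add: card_distinct set_monomials_upto)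
qed

lemma column_relation_row:
  assumes "column_relation k \<beta> p" "i' + j' \<le> k"
  shows "(\<Sum>(i, j)\<in>{(i, j). i + j \<le> k}. coeff (coeff p j) i * \<beta> (i' + i) (j' + j)) = 0"
proof -
  let ?ms = "monomials_upto k"
  have "(i', j') \<in> set ?ms" using assms by (simp add: set_monomials_upto)
  then obtain r where r: "r < length ?ms" "?ms ! r = (i', j')" by (auto simp: in_set_conv_nth)
  have "column_eval k \<beta> p $ r = 0" using assms r by (simp add: column_relation_def)
  then show ?thesis
    unfolding column_eval_def moment_matrix_def
    using moment_matrix_on_mult_vec[OF distinct_monomials_upto r(1), of \<beta> "\<lambda>s. coeff (coeff p (snd s)) (fst s)"] r(2)
    by (simp add: set_monomials_upto case_prod_unfold)
qed

text \<open>Recursive generation carries the cubic relation to its multiples by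
  \<open>X^a Y^b\<close> of degree at most \<open>k\<close>; the row \<open>X^i' Y^j'\<close> of
  such a multiple is the claimed recursion.\<close>

lemma moment_recursion:
  assumes cr: "column_relation k \<beta> ((polyY - polyC \<alpha>1) * (polyY - polyC \<alpha>2) * (polyY - polyC \<alpha>3))"
    and rg: "recursively_generated k \<beta>" and k: "3 \<le> k" and ij: "i + j + 3 \<le> 2 * k"
  shows "\<beta> i (j + 3) = (\<alpha>1 + \<alpha>2 + \<alpha>3) * \<beta> i (j + 2)
    - (\<alpha>1 * \<alpha>2 + \<alpha>1 * \<alpha>3 + \<alpha>2 * \<alpha>3) * \<beta> i (j + 1) + \<alpha>1 * \<alpha>2 * \<alpha>3 * \<beta> i j"
proof -
  define p where "p = (polyY - polyC \<alpha>1) * (polyY - polyC \<alpha>2) * (polyY - polyC \<alpha>3)"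
  \<comment> \<open>The row takes as much of \<open>X^i Y^j\<close> as degree \<open>k\<close>
    permits, which leaves \<open>a + b\<close> at most \<open>k - 3\<close> for the
    multiplier.\<close>
  define i' j' where "i' = min i k" and "j' = min j (k - i')"
  define a b where "a = i - i'" and "b = j - j'"
  define q :: "real poly poly" where "q = monom (monom 1 a) b"
  have i: "i = i' + a" and j: "j = j' + b" and ij': "i' + j' \<le> k" and ab: "a + b + 3 \<le> k"
    using ij k by (auto simp: i'_def j'_def a_def b_def)
  have p: "total_degree_le 3 p"
    using total_degree_le_mult[OF total_degree_le_mult[OF total_degree_le_linear total_degree_le_linear]
        total_degree_le_linear] by (simp add: p_def numeral_3_eq_3)
  have q: "total_degree_le (a + b) q" unfolding q_def by (rule total_degree_le_monom)
  have pq: "total_degree_le (3 + (a + b)) (p * q)" by (rule total_degree_le_mult[OF p q])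
  have mono: "total_degree_le d r \<Longrightarrow> d \<le> k \<Longrightarrow> total_degree_le k r" for d r
    by (auto simp: total_degree_le_def intro: order.trans)
  have "column_relation k \<beta> (p * q)"
    using rg cr mono[OF p] mono[OF q] mono[OF pq] ab k
    unfolding recursively_generated_def p_def[symmetric] by (metis add.commute add_leD1 )
  from column_relation_row[OF this ij']
  have "(\<Sum>(s, t)\<in>{(i, j). i + j \<le> k}. coeff (coeff (p * q) t) s * \<beta> (i' + s) (j' + t)) = 0" .
  also have "(\<Sum>(s, t)\<in>{(i, j). i + j \<le> k}. coeff (coeff (p * q) t) s * \<beta> (i' + s) (j' + t)) =
      (\<Sum>(s, t)\<in>(\<lambda>t. (a, b + t)) ` {..3}. coeff (coeff (p * q) t) s * \<beta> (i' + s) (j' + t))"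
  proof (rule sum.mono_neutral_right)
    show "finite {(i, j). i + j \<le> k}"
      by (rule finite_subset[of _ "{..k} \<times> {..k}"]) auto
    show "(\<lambda>t. (a, b + t)) ` {..3} \<subseteq> {(i, j). i + j \<le> k}" using ab by auto
    show "\<forall>x\<in>{(i, j). i + j \<le> k} - (\<lambda>t. (a, b + t)) ` {..3}.
        (case x of (s, t) \<Rightarrow> coeff (coeff (p * q) t) s * \<beta> (i' + s) (j' + t)) = 0"
    proof clarsimp
      fix s t assume st: "(s, t) \<notin> (\<lambda>t. (a, b + t)) ` {..3}" and nz: "\<beta> (i' + s) (j' + t) \<noteq> 0"
      have c: "coeff (coeff p u) v = 0" if "u > 3 \<or> v > 0" for u v
        using that by (auto simp: p_def polyY_minus_polyC coeff_pCons split: nat.splits)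
      have "coeff (coeff (p * q) t) s =
          (if t < b then 0 else if s < a then 0 else coeff (coeff p (t - b)) (s - a))"
        by (simp add: mult.commute[of p] q_def coeff_monom_mult)
      moreover have "t - b > 3 \<or> s - a > 0" if "b \<le> t" "a \<le> s"
      proof (rule ccontr)
        assume "\<not> ?thesis"
        then have "(s, t) = (a, b + (t - b))" "t - b \<in> {..3}" using that by auto
        then show False using st by blast
      qed
      ultimately show "coeff (coeff (p * q) t) s = 0" using c by auto
    qed
  qed
  also have "\<dots> = (\<Sum>t\<le>3. coeff (coeff p t) 0 * \<beta> i (j + t))"
    by (subst sum.reindex) (auto simp: inj_on_def mult.commute[of p] q_def coeff_monom_mult i j add.assoc)
  also have "\<dots> = \<beta> i (j + 3) - (\<alpha>1 + \<alpha>2 + \<alpha>3) * \<beta> i (j + 2)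
      + (\<alpha>1 * \<alpha>2 + \<alpha>1 * \<alpha>3 + \<alpha>2 * \<alpha>3) * \<beta> i (j + 1) - \<alpha>1 * \<alpha>2 * \<alpha>3 * \<beta> i j"
    by (simp add: p_def polyY_minus_polyC numeral_3_eq_3 numeral_2_eq_2 algebra_simps)
  finally show ?thesis by simp
qed

text \<open>In \<open>j\<close>, both sides obey the same recursion of order three, and they agree
  for \<open>j\<close> up to 2.\<close>

lemma moments_on_lines:
  fixes \<beta> :: "nat \<Rightarrow> nat \<Rightarrow> real"
  assumes rec: "\<And>i j. i + j + 3 \<le> d \<Longrightarrow> \<beta> i (j + 3) = (\<alpha>1 + \<alpha>2 + \<alpha>3) * \<beta> i (j + 2)
      - (\<alpha>1 * \<alpha>2 + \<alpha>1 * \<alpha>3 + \<alpha>2 * \<alpha>3) * \<beta> i (j + 1) + \<alpha>1 * \<alpha>2 * \<alpha>3 * \<beta> i j"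
    and low: "\<And>i j. i + j \<le> d \<Longrightarrow> j \<le> 2 \<Longrightarrow> \<beta> i j = (\<Sum>y\<in>{\<alpha>1, \<alpha>2, \<alpha>3}. m y i * y ^ j)"
    and "i + j \<le> d"
  shows "\<beta> i j = (\<Sum>y\<in>{\<alpha>1, \<alpha>2, \<alpha>3}. m y i * y ^ j)"
  using assms(3)
proof (induction j rule: less_induct)
  case (less j)
  show ?case
  proof (cases "j \<le> 2")
    case False
    then obtain l where l: "j = l + 3" by (metis add.commute le_Suc_ex not_less_eq_eq numeral_2_eq_2 numeral_3_eq_3)
    have IH: "\<beta> i t = (\<Sum>y\<in>{\<alpha>1, \<alpha>2, \<alpha>3}. m y i * y ^ t)" if "t < j" for t
      using less.IH[of t] that less.prems by simp
    have "\<beta> i j = (\<alpha>1 + \<alpha>2 + \<alpha>3) * \<beta> i (l + 2)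
      - (\<alpha>1 * \<alpha>2 + \<alpha>1 * \<alpha>3 + \<alpha>2 * \<alpha>3) * \<beta> i (l + 1) + \<alpha>1 * \<alpha>2 * \<alpha>3 * \<beta> i l"
      using rec[of i l] less.prems by (simp add: l)
    also have "\<dots> = (\<Sum>y\<in>{\<alpha>1, \<alpha>2, \<alpha>3}. (\<alpha>1 + \<alpha>2 + \<alpha>3) * (m y i * y ^ (l + 2))
        - (\<alpha>1 * \<alpha>2 + \<alpha>1 * \<alpha>3 + \<alpha>2 * \<alpha>3) * (m y i * y ^ (l + 1))
        + \<alpha>1 * \<alpha>2 * \<alpha>3 * (m y i * y ^ l))"
    proof -
      have "l + 2 < j" "l + 1 < j" "l < j" by (simp_all add: l)
      note IH[OF this(1)] IH[OF this(2)] IH[OF this(3)]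
      then show ?thesis
        by (simp only: sum_distrib_left sum_subtractf sum.distrib)
    qed
    also have "\<dots> = (\<Sum>y\<in>{\<alpha>1, \<alpha>2, \<alpha>3}. m y i * ((\<alpha>1 + \<alpha>2 + \<alpha>3) * y ^ (l + 2)
        - (\<alpha>1 * \<alpha>2 + \<alpha>1 * \<alpha>3 + \<alpha>2 * \<alpha>3) * y ^ (l + 1) + \<alpha>1 * \<alpha>2 * \<alpha>3 * y ^ l))"
      by (intro sum.cong refl) (simp only: algebra_simps)
    also have "\<dots> = (\<Sum>y\<in>{\<alpha>1, \<alpha>2, \<alpha>3}. m y i * y ^ j)"
    proof (intro sum.cong refl)
      fix y assume "y \<in> {\<alpha>1, \<alpha>2, \<alpha>3}"
      then have "y ^ l * ((y - \<alpha>1) * (y - \<alpha>2) * (y - \<alpha>3)) = 0" by auto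
      then have "(\<alpha>1 + \<alpha>2 + \<alpha>3) * y ^ (l + 2)
        - (\<alpha>1 * \<alpha>2 + \<alpha>1 * \<alpha>3 + \<alpha>2 * \<alpha>3) * y ^ (l + 1) + \<alpha>1 * \<alpha>2 * \<alpha>3 * y ^ l = y ^ j"
        by (simp add: l power_add power2_eq_square power3_eq_cube algebra_simps)
      then show "m y i * ((\<alpha>1 + \<alpha>2 + \<alpha>3) * y ^ (l + 2)
        - (\<alpha>1 * \<alpha>2 + \<alpha>1 * \<alpha>3 + \<alpha>2 * \<alpha>3) * y ^ (l + 1) + \<alpha>1 * \<alpha>2 * \<alpha>3 * y ^ l) = m y i * y ^ j"
        by simp
    qed
    finally show ?thesis .
  qed (use low less.prems in simp)
qed

section \<open>Rank\<close>

lemma (in vec_space) rank_ge_card: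
  assumes A: "A \<in> carrier_mat n nc" and S: "S \<subseteq> {..<nc}"
    and indep: "\<And>c j. (\<And>i. i < n \<Longrightarrow> (\<Sum>j\<in>S. c j * A $$ (i, j)) = 0) \<Longrightarrow> j \<in> S \<Longrightarrow> c j = 0"
  shows "card S \<le> rank A"
proof -
  have fin: "finite S" using S finite_subset by blast
  have index: "col A j $ i = A $$ (i, j)" if "i < n" "j \<in> S" for i j
    using A S that by auto
  have inj: "inj_on (col A) S"
  proof (rule inj_onI, rule ccontr)
    fix j l assume jl: "j \<in> S" "l \<in> S" "col A j = col A l" "j \<noteq> l"
    \<comment> \<open>Two equal columns would give a linear relation with coefficients 1 and
      -1.\<close>
    define c where "c t = (if t = j then 1 else if t = l then - 1 else 0 :: 'a)" for t
    have "c j = 0"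
    proof (rule indep[OF _ jl(1)])
      fix i assume i: "i < n"
      have "(\<Sum>t\<in>S. c t * A $$ (i, t)) = (\<Sum>t\<in>{j, l}. c t * A $$ (i, t))"
        using jl fin by (intro sum.mono_neutral_right) (auto simp: c_def)
      also have "\<dots> = A $$ (i, j) - A $$ (i, l)" using jl(4) by (simp add: c_def)
      also have "\<dots> = 0" using index[OF i jl(1)] index[OF i jl(2)] jl(3) by simp
      finally show "(\<Sum>t\<in>S. c t * A $$ (i, t)) = 0" .
    qed
    then show False by (simp add: c_def)
  qed
  have carrier: "col A ` S \<subseteq> carrier_vec n" using A by auto
  have "lin_indpt (col A ` S)"
  proof (rule finite_lin_indpt2)
    fix a assume a: "lincomb a (col A ` S) = 0\<^sub>v n"
    have "(\<Sum>j\<in>S. a (col A j) * A $$ (i, j)) = 0" if i: "i < n" for i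
    proof -
      have "(\<Sum>j\<in>S. a (col A j) * A $$ (i, j)) = (\<Sum>x\<in>col A ` S. a x * x $ i)"
        using index[OF i] by (simp add: sum.reindex[OF inj])
      also have "\<dots> = lincomb a (col A ` S) $ i" by (rule lincomb_index[OF i carrier, symmetric])
      finally show ?thesis using a i by simp
    qed
    then show "\<forall>v\<in>col A ` S. a v = 0" using indep[of "\<lambda>j. a (col A j)"] by blast
  qed (use fin carrier in auto)
  moreover have "col A ` S \<subseteq> set (cols A)" using A S by (auto simp: cols_def)
  ultimately have "card (col A ` S) \<le> rank A" using rank_ge_card_indpt[OF A] by blast
  then show ?thesis by (simp add: card_image[OF inj])
qed

lemma (in vec_space) rank_le_card:
  assumes "finite W" "A \<in> carrier_mat n nc"
    and "\<And>i j. i < n \<Longrightarrow> j < nc \<Longrightarrow> A $$ (i, j) = (\<Sum>w\<in>W. u w i * v w j)"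
  shows "rank A \<le> card W"
  using assms
proof (induction W arbitrary: A rule: finite_induct)
  case empty
  then have "A = 0\<^sub>m n nc" by auto
  then show ?case by (simp add: rank_0I)
next
  case (insert w W)
  define B where "B = Matrix.mat n nc (\<lambda>(i, j). u w i * v w j)"
  define C where "C = Matrix.mat n nc (\<lambda>(i, j). \<Sum>w\<in>W. u w i * v w j)"
  have "A = B + C" using insert by (auto simp: B_def C_def)
  moreover have "rank (B + C) \<le> rank B + rank C"
    by (rule rank_subadditive[where nc = nc]) (simp_all add: B_def C_def)
  moreover have "rank B \<le> 1"
    by (rule rank_le_1_product_entries[where nc = nc and f = "u w" and g = "v w"]) (auto simp: B_def)
  moreover have "rank C \<le> card W" by (rule insert.IH) (auto simp: C_def)
  ultimately show ?case using insert by simp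
qed

text \<open>Each atom contributes one matrix of rank at most one.\<close>

lemma rank_moment_matrix_le:
  assumes "finite W"
    and \<beta>: "\<And>i j. i + j \<le> 2 * k \<Longrightarrow> \<beta> i j = (\<Sum>w\<in>W. \<rho> w * fst w ^ i * snd w ^ j)"
  shows "mat_rank (moment_matrix k \<beta>) \<le> card W"
proof -
  let ?ms = "monomials_upto k"
  let ?A = "moment_matrix k \<beta>"
  interpret vec_space "TYPE(real)" "length ?ms" .
  have "rank ?A \<le> card W"
  proof (rule rank_le_card[OF assms(1)])
    show "?A \<in> carrier_mat (length ?ms) (length ?ms)" by (simp add: moment_matrix_def moment_matrix_on_def)
    fix i j assume ij: "i < length ?ms" "j < length ?ms"
    then have "?ms ! i \<in> set ?ms" "?ms ! j \<in> set ?ms" by auto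
    then have "fst (?ms ! i) + snd (?ms ! i) \<le> k" "fst (?ms ! j) + snd (?ms ! j) \<le> k"
      by (auto simp: set_monomials_upto case_prod_unfold)
    then show "?A $$ (i, j) = (\<Sum>w\<in>W. (\<rho> w * fst w ^ fst (?ms ! i) * snd w ^ snd (?ms ! i)) *
        (fst w ^ fst (?ms ! j) * snd w ^ snd (?ms ! j)))"
      using ij by (simp add: moment_matrix_def moment_matrix_on_def \<beta> power_add mult_ac)
  qed
  then show ?thesis by (simp add: mat_rank_def moment_matrix_def)
qed

text \<open>A linear relation between the columns in \<open>ms\<close> would be a zero of the
  positive definite form.\<close>

lemma rank_moment_matrix_ge:
  assumes pd: "pos_def (moment_matrix_on ms \<beta>)"
    and ms: "distinct ms" "set ms \<subseteq> {(i, j). i + j \<le> k}"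
  shows "length ms \<le> mat_rank (moment_matrix k \<beta>)"
proof -
  let ?ns = "monomials_upto k"
  let ?A = "moment_matrix k \<beta>"
  interpret vec_space "TYPE(real)" "length ?ns" .
  define S where "S = {j. j < length ?ns \<and> ?ns ! j \<in> set ms}"
  have bij: "bij_betw (\<lambda>j. ?ns ! j) S (set ms)"
    unfolding bij_betw_def
  proof
    show "inj_on (\<lambda>j. ?ns ! j) S"
      by (rule inj_on_nth[OF distinct_monomials_upto]) (auto simp: S_def)
    show "(\<lambda>j. ?ns ! j) ` S = set ms"
    proof
      show "set ms \<subseteq> (\<lambda>j. ?ns ! j) ` S"
      proof
        fix s assume s: "s \<in> set ms"
        then have "s \<in> set ?ns" using ms(2) unfolding set_monomials_upto by blast
        then obtain j where "j < length ?ns" "?ns ! j = s" unfolding in_set_conv_nth by blast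
        then show "s \<in> (\<lambda>j. ?ns ! j) ` S" using s by (intro image_eqI[of _ _ j]) (simp_all add: S_def)
      qed
    qed (auto simp: S_def)
  qed
  have "card S \<le> rank ?A"
  proof (rule rank_ge_card)
    show "?A \<in> carrier_mat (length ?ns) (length ?ns)" by (simp add: moment_matrix_def moment_matrix_on_def)
    show "S \<subseteq> {..<length ?ns}" by (auto simp: S_def)
  next
    fix c :: "nat \<Rightarrow> real" and j
    assume 0: "\<And>i. i < length ?ns \<Longrightarrow> (\<Sum>j\<in>S. c j * ?A $$ (i, j)) = 0" and j: "j \<in> S"
    define c' where "c' s = c (the_inv_into S (\<lambda>j. ?ns ! j) s)" for s
    have c': "c' (?ns ! j) = c j" if "j \<in> S" for j
      using the_inv_into_f_f[OF bij_betw_imp_inj_on[OF bij] that] by (simp add: c'_def)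
    have "quad_form (set ms) \<beta> c' = (\<Sum>i\<in>S. \<Sum>j\<in>S. c i * c j * ?A $$ (i, j))"
      unfolding quad_form_def sum.reindex_bij_betw[OF bij, symmetric]
      by (intro sum.cong refl) (auto simp: c' moment_matrix_def moment_matrix_on_def S_def)
    also have "\<dots> = (\<Sum>i\<in>S. c i * (\<Sum>j\<in>S. c j * ?A $$ (i, j)))"
      by (simp add: sum_distrib_left mult.assoc)
    also have "\<dots> = 0" using 0 by (intro sum.neutral) (auto simp: S_def)
    finally have "quad_form (set ms) \<beta> c' = 0" .
    moreover have "?ns ! j \<in> set ms" using j by (simp add: S_def)
    ultimately have "c' (?ns ! j) = 0" using pos_def_quad_form[OF pd ms(1)] by (metis less_irrefl)
    then show "c j = 0" using c'[OF j] by simp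
  qed
  then show ?thesis
    using bij_betw_same_card[OF bij] distinct_card[OF ms(1)] by (simp add: mat_rank_def moment_matrix_def)
qed

section \<open>Representing measures\<close>

lemma finitely_atomic_measure:
  fixes W :: "(real \<times> real) set"
  assumes W: "finite W" "W \<subseteq> K" and K: "closed K" and pos: "\<And>w. w \<in> W \<Longrightarrow> 0 < \<rho> w"
    and \<beta>: "\<And>i j. i + j \<le> 2 * k \<Longrightarrow> \<beta> i j = (\<Sum>w\<in>W. \<rho> w * fst w ^ i * snd w ^ j)"
  shows "\<exists>\<mu>. representing_measure k K \<beta> \<mu> \<and> atomic_measure (card W) \<mu>"
proof -
  \<comment> \<open>A point measure lives on the power set of \<open>W\<close>; its image under the
    identity is a Borel measure on the plane.\<close>
  define \<mu> where "\<mu> = distr (point_measure W (\<lambda>w. ennreal (\<rho> w))) borel (\<lambda>w. w)"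
  have meas: "(\<lambda>w. w) \<in> measurable (point_measure W (\<lambda>w. ennreal (\<rho> w))) borel" by simp
  have sets: "sets \<mu> = sets borel" by (simp add: \<mu>_def)
  have em: "emeasure \<mu> A = (\<Sum>w\<in>W. ennreal (\<rho> w) * emeasure (return borel w) A)" if A: "A \<in> sets borel" for A
  proof -
    have "emeasure \<mu> A = emeasure (point_measure W (\<lambda>w. ennreal (\<rho> w))) (A \<inter> W)"
      using emeasure_distr[OF meas A] by (simp add: \<mu>_def space_point_measure)
    also have "\<dots> = (\<Sum>w\<in>A \<inter> W. ennreal (\<rho> w))"
      using W by (intro emeasure_point_measure_finite2) auto
    also have "\<dots> = (\<Sum>w\<in>W. ennreal (\<rho> w) * emeasure (return borel w) A)"
      using W A by (intro sum.mono_neutral_cong_left) (auto simp: indicator_def split: if_splits)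
    finally show ?thesis .
  qed
  have "measure_support \<mu> \<subseteq> K"
  proof (rule subsetI, rule ccontr)
    fix z assume z: "z \<in> measure_support \<mu>" "z \<notin> K"
    \<comment> \<open>The complement of \<open>K\<close> is open and of measure 0, so no point of it
      lies in the support.\<close>
    have "emeasure \<mu> (- K) = 0"
      using W K em[of "- K"] by (auto simp: borel_closed)
    moreover have "0 < emeasure \<mu> (- K)"
      using z K by (auto simp: measure_support_def open_Compl)
    ultimately show False by simp
  qed
  moreover have "set_integrable \<mu> K (\<lambda>(x, y). x ^ i * y ^ j) \<and>
      \<beta> i j = set_lebesgue_integral \<mu> K (\<lambda>(x, y). x ^ i * y ^ j)" if ij: "i + j \<le> 2 * k" for i j
  proof -
    define F where "F = (\<lambda>w :: real \<times> real. indicator K w *\<^sub>R (case w of (x, y) \<Rightarrow> x ^ i * y ^ j))"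
    have "(\<lambda>w::real \<times> real. fst w ^ i * snd w ^ j) \<in> borel_measurable borel"
      by (intro borel_measurable_continuous_onI continuous_intros)
    moreover have "K \<in> sets borel" using K by (rule borel_closed)
    ultimately have F: "F \<in> borel_measurable borel"
      unfolding F_def case_prod_unfold by (intro borel_measurable_scaleR borel_measurable_indicator)
    have "integrable \<mu> F"
      unfolding \<mu>_def integrable_distr_eq[OF meas F]
      by (rule integrable_point_measure_finite[OF W(1)])
    moreover have "integral\<^sup>L \<mu> F = (\<Sum>w\<in>W. \<rho> w *\<^sub>R F w)"
      unfolding \<mu>_def integral_distr[OF meas F]
      using lebesgue_integral_point_measure_finite[OF W(1), of \<rho> F] pos by (simp add: less_imp_le)
    moreover have "\<dots> = \<beta> i j"
      using W by (auto simp: \<beta>[OF ij] F_def case_prod_unfold mult.assoc intro!: sum.cong)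
    ultimately show ?thesis by (simp add: set_integrable_def set_lebesgue_integral_def F_def)
  qed
  ultimately have "representing_measure k K \<beta> \<mu>" by (simp add: representing_measure_def sets)
  moreover have "atomic_measure (card W) \<mu>"
    unfolding atomic_measure_def using sets em W(1) pos by blast
  ultimately show ?thesis by blast
qed

text \<open>The Lagrange polynomial is the indicator of line \<open>y\<close> on \<open>K\<close>,
  so the left-hand functional integrates \<open>q^2\<close> over that line. All monomials involved
  have degree at most \<open>(2 * k - 2) + 2\<close>.\<close>

lemma mom_line_moments_nonneg:
  assumes \<mu>: "representing_measure k K \<beta> \<mu>" and K: "\<And>z. z \<in> K \<Longrightarrow> snd z \<in> Y"
    and Y: "finite Y" "card Y = 3" and y: "y \<in> Y" and k: "1 \<le> k" and q: "deg_lt k q"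
  shows "0 \<le> mom (line_moments Y \<beta> y) (q * q)"
proof -
  define F where "F i j z = indicator K z *\<^sub>R (case z of (x, y) \<Rightarrow> x ^ i * y ^ j)"
    for i j and z :: "real \<times> real"
  let ?l = "lagrange Y y"
  have qq: "degree (q * q) \<le> 2 * k - 2"
    using deg_lt_mult[OF q q] k by (auto simp: deg_lt_iff)
  have F: "integrable \<mu> (F i j)" "\<beta> i j = integral\<^sup>L \<mu> (F i j)" if "i + j \<le> 2 * k" for i j
    using \<mu> that by (simp_all add: representing_measure_def set_integrable_def set_lebesgue_integral_def F_def[abs_def])
  have int: "integrable \<mu> (\<lambda>z. coeff (q * q) i * (coeff ?l j * F i j z))" if "i \<le> 2 * k - 2" "j < 3" for i j
    using F(1)[of i j] that k by simp
  have "mom (line_moments Y \<beta> y) (q * q) =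
      (\<Sum>i\<le>2 * k - 2. \<Sum>j<3. coeff (q * q) i * (coeff ?l j * \<beta> i j))"
    using mom_eq_sum[OF qq] Y(2) by (simp add: line_moments_def sum_distrib_left)
  also have "\<dots> = (\<Sum>i\<le>2 * k - 2. \<Sum>j<3. \<integral>z. coeff (q * q) i * (coeff ?l j * F i j z) \<partial>\<mu>)"
    using k by (intro sum.cong refl) (auto simp: F(2))
  also have "\<dots> = (\<Sum>i\<le>2 * k - 2. \<integral>z. (\<Sum>j<3. coeff (q * q) i * (coeff ?l j * F i j z)) \<partial>\<mu>)"
    by (intro sum.cong refl Bochner_Integration.integral_sum[symmetric] int) simp_all
  also have "\<dots> = (\<integral>z. (\<Sum>i\<le>2 * k - 2. \<Sum>j<3. coeff (q * q) i * (coeff ?l j * F i j z)) \<partial>\<mu>)"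
    by (intro Bochner_Integration.integral_sum[symmetric] Bochner_Integration.integrable_sum int) simp_all
  also have "\<dots> \<ge> 0"
  proof (rule Bochner_Integration.integral_nonneg)
    fix z assume "z \<in> space \<mu>"
    show "0 \<le> (\<Sum>i\<le>2 * k - 2. \<Sum>j<3. coeff (q * q) i * (coeff ?l j * F i j z))"
    proof (cases "z \<in> K")
      case True
      then have z: "snd z \<in> Y" by (rule K)
      have "deg_lt 3 ?l"
        using deg_lt_lagrange[OF Y(1) y] Y(2) by simp
      have "(\<Sum>i\<le>2 * k - 2. \<Sum>j<3. coeff (q * q) i * (coeff ?l j * F i j z)) =
          (\<Sum>i\<le>2 * k - 2. coeff (q * q) i * fst z ^ i) * (\<Sum>j<3. coeff ?l j * snd z ^ j)"
        unfolding sum_product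
        by (intro sum.cong refl) (use True in \<open>simp add: F_def case_prod_unfold\<close>)
      also have "(\<Sum>j<3. coeff ?l j * snd z ^ j) = poly ?l (snd z)"
        using \<open>deg_lt 3 ?l\<close> by (simp add: poly_eq_sum_lessThan)
      also have "\<dots> = (if snd z = y then 1 else 0)" by (rule poly_lagrange[OF Y(1) z])
      also have "(\<Sum>i\<le>2 * k - 2. coeff (q * q) i * fst z ^ i) = poly (q * q) (fst z)"
        using poly_eq_sum_lessThan[of "Suc (2 * k - 2)" "q * q"] qq
        by (simp only: deg_lt_Suc lessThan_Suc_atMost)
      finally show ?thesis by simp
    qed (simp add: F_def)
  qed
  finally show ?thesis .
qed

theorem corollary4p3:
  fixes k :: nat and \<alpha>1 \<alpha>2 \<alpha>3 :: real
    and K :: "(real \<times> real) set" and \<beta> :: "nat \<Rightarrow> nat \<Rightarrow> real"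
  assumes "3 \<le> k"
    and "\<alpha>1 \<noteq> \<alpha>2" "\<alpha>1 < \<alpha>3" "\<alpha>2 < \<alpha>3"
    and "K = {(x, y). (y - \<alpha>1) * (y - \<alpha>2) * (y - \<alpha>3) = 0}"
    and "0 < \<beta> 0 0"
    and "column_relation k \<beta> ((polyY - polyC \<alpha>1) * (polyY - polyC \<alpha>2) * (polyY - polyC \<alpha>3))"
    and "recursively_generated k \<beta>"
    and "pos_def (moment_matrix_on (C2 k) \<beta>)"
  shows "((\<exists>\<mu>. representing_measure k K \<beta> \<mu>) \<longleftrightarrow> pos_semidef (N_matrix k \<beta> \<alpha>1 \<alpha>2 \<alpha>3)) \<and>
    ((\<exists>\<mu>. representing_measure k K \<beta> \<mu>) \<longrightarrow>
      (\<exists>\<mu>. representing_measure k K \<beta> \<mu> \<and> atomic_measure (mat_rank (moment_matrix k \<beta>)) \<mu>))"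
proof -
  define Y where "Y = {\<alpha>1, \<alpha>2, \<alpha>3}"
  have Y: "finite Y" "card Y = 3" using assms(2-4) by (auto simp: Y_def)
  have K: "z \<in> K \<longleftrightarrow> snd z \<in> Y" for z by (cases z) (auto simp: assms(5) Y_def)
  have "K = UNIV \<times> Y" using K by auto
  then have closed: "closed K" using Y by (simp add: closed_Times finite_imp_closed)
  obtain n where n: "k = Suc n" using \<open>3 \<le> k\<close> by (cases k) auto
  define m where "m = line_moments Y \<beta>"
  have rec: "\<beta> i (j + 3) = (\<alpha>1 + \<alpha>2 + \<alpha>3) * \<beta> i (j + 2)
    - (\<alpha>1 * \<alpha>2 + \<alpha>1 * \<alpha>3 + \<alpha>2 * \<alpha>3) * \<beta> i (j + 1) + \<alpha>1 * \<alpha>2 * \<alpha>3 * \<beta> i j"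
    if "i + j + 3 \<le> 2 * k" for i j
    using moment_recursion[OF assms(7,8,1) that] .
  \<comment> \<open>This holds for every \<open>i\<close>, also where \<open>m\<close> uses values
    of \<open>\<beta>\<close> beyond degree \<open>2 * k\<close>.\<close>
  have m_low: "(\<Sum>y\<in>Y. m y i * y ^ j) = \<beta> i j" if "j \<le> 2" for i j
    unfolding m_def using that by (intro sum_line_moments Y) (simp add: Y)
  have \<beta>: "\<beta> i j = (\<Sum>y\<in>Y. m y i * y ^ j)" if "i + j \<le> 2 * k" for i j
    using moments_on_lines[of "2 * k" \<beta> \<alpha>1 \<alpha>2 \<alpha>3 m, OF rec _ that] m_low unfolding Y_def by auto
  have N: "pos_semidef (N_matrix k \<beta> \<alpha>1 \<alpha>2 \<alpha>3) \<longleftrightarrow>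
      (\<forall>y\<in>Y. \<forall>q. deg_lt k q \<longrightarrow> 0 \<le> mom (m y) (q * q))"
    using pos_semidef_N_iff[of k \<beta> m \<alpha>1 \<alpha>2 \<alpha>3] \<beta> Y \<open>3 \<le> k\<close> unfolding Y_def by simp
  have nec: "pos_semidef (N_matrix k \<beta> \<alpha>1 \<alpha>2 \<alpha>3)" if "representing_measure k K \<beta> \<mu>" for \<mu>
    unfolding N m_def using mom_line_moments_nonneg[OF that _ Y] K \<open>3 \<le> k\<close> by simp
  have suff: "\<exists>\<mu>. representing_measure k K \<beta> \<mu> \<and> atomic_measure (mat_rank (moment_matrix k \<beta>)) \<mu>"
    if psd: "pos_semidef (N_matrix k \<beta> \<alpha>1 \<alpha>2 \<alpha>3)"
  proof -
    have "\<exists>m' c. (\<forall>y\<in>Y. (\<forall>i\<le>2 * n. m' y i = m y i) \<and> atomic_upto (2 * n + 3) (m' y) (c y)) \<and>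
        (\<forall>j\<le>1. (\<Sum>y\<in>Y. m' y (2 * n + 1) * y ^ j) = (\<Sum>y\<in>Y. m y (2 * n + 1) * y ^ j)) \<and>
        (\<Sum>y\<in>Y. m' y (2 * n + 2)) = (\<Sum>y\<in>Y. m y (2 * n + 2)) \<and> sum c Y = 3 * (n + 1)"
    proof (rule three_lines[OF Y])
      show "0 \<le> mom (m y) (q * q)" if "y \<in> Y" "deg_lt (Suc n) q" for y q
        using psd[unfolded N, unfolded n] that by blast
      show "0 < (\<Sum>y\<in>Y. mom (m y) (p y * p y))"
        if "\<And>y. y \<in> Y \<Longrightarrow> degree (p y) \<le> Suc n \<and> coeff (p y) (Suc n) = a"
          "affine_on Y (\<lambda>y. coeff (p y) n)" "\<exists>y\<in>Y. p y \<noteq> 0" for p a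
        by (rule pos_def_C2_imp[OF Y assms(9)[unfolded n] _ that]) (use \<beta> n in auto)
    qed
    then obtain m' c where mc: "\<forall>y\<in>Y. (\<forall>i\<le>2 * n. m' y i = m y i) \<and> atomic_upto (2 * n + 3) (m' y) (c y)"
      and odd: "\<forall>j\<le>1. (\<Sum>y\<in>Y. m' y (2 * n + 1) * y ^ j) = (\<Sum>y\<in>Y. m y (2 * n + 1) * y ^ j)"
      and even: "(\<Sum>y\<in>Y. m' y (2 * n + 2)) = (\<Sum>y\<in>Y. m y (2 * n + 2))"
      and c: "sum c Y = 3 * (n + 1)"
      by (elim exE conjE)
    have m': "m' y i = m y i" if "y \<in> Y" "i \<le> 2 * n" for y i
      using mc that by blast
    have "\<forall>y\<in>Y. \<exists>Z \<rho>. finite Z \<and> card Z = c y \<and> (\<forall>z\<in>Z. 0 < \<rho> z) \<and>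
        (\<forall>i<2 * n + 3. m' y i = (\<Sum>z\<in>Z. \<rho> z * z ^ i))"
      using mc unfolding atomic_upto_def by blast
    from bchoice[OF this] obtain Z where "\<forall>y\<in>Y. \<exists>\<rho>. finite (Z y) \<and> card (Z y) = c y \<and>
        (\<forall>z\<in>Z y. 0 < \<rho> z) \<and> (\<forall>i<2 * n + 3. m' y i = (\<Sum>z\<in>Z y. \<rho> z * z ^ i))"
      by blast
    from bchoice[OF this] obtain \<rho> where Z: "\<And>y. y \<in> Y \<Longrightarrow> finite (Z y) \<and> card (Z y) = c y \<and>
        (\<forall>z\<in>Z y. 0 < \<rho> y z) \<and> (\<forall>i<2 * n + 3. m' y i = (\<Sum>z\<in>Z y. \<rho> y z * z ^ i))"
      by blast
    define W where "W = (\<lambda>(y, z). (z, y)) ` Sigma Y Z"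
    have inj: "inj_on (\<lambda>(y, z). (z, y)) (Sigma Y Z)" by (auto simp: inj_on_def)
    have W: "finite W" "W \<subseteq> K" using Y Z by (auto simp: W_def K)
    have cardW: "card W = 3 * k"
      using Y Z c by (simp add: W_def card_image[OF inj] n)
    have \<beta>': "\<beta> i j = (\<Sum>y\<in>Y. m' y i * y ^ j)" if "i + j \<le> 2 * k" for i j
      unfolding Y_def
    proof (rule moments_on_lines[of "2 * k" \<beta>, OF rec _ that])
      fix i j assume ij: "i + j \<le> 2 * k" "j \<le> (2::nat)"
      \<comment> \<open>The bound \<open>2 * k = 2 * n + 2\<close> on the degree leaves only the
        combinations of top moments that the adjustment has preserved.\<close>
      then consider "i \<le> 2 * n" | "i = 2 * n + 1" "j \<le> 1" | "i = 2 * n + 2" "j = 0"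
        using n by linarith
      then have "(\<Sum>y\<in>Y. m' y i * y ^ j) = (\<Sum>y\<in>Y. m y i * y ^ j)"
      proof cases
        case 1
        then show ?thesis by (simp add: m')
      next
        case 2
        then show ?thesis using odd by blast
      next
        case 3
        then show ?thesis using even by (simp only: power_0 mult_1_right)
      qed
      then show "\<beta> i j = (\<Sum>y\<in>{\<alpha>1, \<alpha>2, \<alpha>3}. m' y i * y ^ j)"
        using m_low[OF ij(2)] unfolding Y_def by simp
    qed
    have "\<beta> i j = (\<Sum>w\<in>W. \<rho> (snd w) (fst w) * fst w ^ i * snd w ^ j)" if ij: "i + j \<le> 2 * k" for i j
    proof -
      have "\<beta> i j = (\<Sum>y\<in>Y. \<Sum>z\<in>Z y. \<rho> y z * z ^ i * y ^ j)"
        using Z ij n by (simp add: \<beta>'[OF ij] sum_distrib_right)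
      also have "\<dots> = (\<Sum>w\<in>W. \<rho> (snd w) (fst w) * fst w ^ i * snd w ^ j)"
        unfolding W_def using Y Z
        by (subst sum.reindex[OF inj]) (simp add: sum.Sigma case_prod_unfold)
      finally show ?thesis .
    qed
    note rep = this
    \<comment> \<open>The \<open>3 * k\<close> atoms bound the rank from above, the
      \<open>3 * k\<close> monomials of \<open>C2 k\<close> from below.\<close>
    have "mat_rank (moment_matrix k \<beta>) \<le> 3 * k"
      using rank_moment_matrix_le[OF W(1) rep] cardW by simp
    moreover have "length (C2 k) = 3 * k" using \<open>3 \<le> k\<close> by (simp add: C2_def)
    then have "3 * k \<le> mat_rank (moment_matrix k \<beta>)"
      using rank_moment_matrix_ge[OF assms(9) distinct_C2, of k] by (auto simp: set_C2)
    ultimately have "mat_rank (moment_matrix k \<beta>) = card W" using cardW by simp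
    moreover have "0 < \<rho> (snd w) (fst w)" if "w \<in> W" for w
      using that Z by (auto simp: W_def)
    ultimately show ?thesis
      using finitely_atomic_measure[OF W closed _ rep] by simp
  qed
  show ?thesis using nec suff by blast
qed

end
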